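(* Let $\mathcal{G}=(\mathcal{V},\mathcal{E},\mathcal{A})$ be a strongly connected directed graph on $N$ nodes with adjacency matrix $\mathcal{A}=[a_{ij}]$. Consider $N$ agents with positions $x_i\in\mathbb{R}$, velocities $v_i\in\mathbb{R}$ and dynamics $$\dot{x}_i=v_i,\qquad \dot{v}_i=b_iu_i+\theta_i^T\phi_i(x_i,v_i),\qquad i=1,\dots,N,$$ where $u_i\in\mathbb{R}$ is the control input, the $b_i\in\mathbb{R}$ are (unknown) nonzero constants whose signs are arbitrary and possibly different, $\theta_i\in\mathbb{R}^{\ell_i}$ is an (unknown) constant vector, and $\phi_i:\mathbb{R}\times\mathbb{R}\to\mathbb{R}^{\ell_i}$ is a (known) smooth function. Let $\rho>0$, $\lambda>0$, $\nu>0$, $\gamma_i>0$ and $\bar{x}_i\in\mathbb{R}$ ($i=1,\dots,N$) be arbitrary constants, let $N(k)=k^2\cos(k)$, and define $$\xi_i:=\sum_{j\in\mathcal{N}_i}a_{ij}(x_i-x_j),\qquad z_i(t):=x_i(t)-\bar{x}_i+\rho\int_0^t\xi_i(\tau)\,d\tau,$$ $$s_i:=\dot{z}_i+\lambda z_i=v_i+\rho\,\xi_i+\lambda\Bigl(x_i-\bar{x}_i+\rho\int_0^t\xi_i(\tau)\,d\tau\Bigr).$$ Let the control inputs be $$u_i=N(\zeta_i)\Bigl[\hat{\theta}_i^T\phi_i(x_i,v_i)+\lambda v_i+\rho\sum_{j\in\mathcal{N}_i}a_{ij}(v_i-v_j)+\nu s_i+\lambda\rho\sum_{j\in\mathcal{N}_i}a_{ij}(x_i-x_j)\Bigr],$$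 where $\hat{\theta}_i\in\mathbb{R}^{\ell_i}$ and $\zeta_i\in\mathbb{R}$ are generated by $$\dot{\hat{\theta}}_i=\gamma_i\phi_i(x_i,v_i)s_i,$$ $$\dot{\zeta}_i=\nu s_i^2+s_i\Bigl[\hat{\theta}_i^T\phi_i(x_i,v_i)+\lambda v_i+\rho\sum_{j\in\mathcal{N}_i}a_{ij}(v_i-v_j)+\rho\lambda\sum_{j\in\mathcal{N}_i}a_{ij}(x_i-x_j)\Bigr].$$ Then, for arbitrary initial conditions $x_i(0),v_i(0),\hat{\theta}_i(0),\zeta_i(0)$, all signals in the closed loop ($x_i$, $v_i$, $z_i$, $s_i$, the integral term in $z_i$, $\hat{\theta}_i$, $\zeta_i$, $u_i$) are bounded on $[0,\infty)$, and for all $i,j\in\{1,\dots,N\}$ $$\lim_{t\to\infty}\bigl(x_i(t)-x_j(t)\bigr)=\lim_{t\to\infty}\bigl(v_i(t)-v_j(t)\bigr)=0$$ with $$\lim_{t\to\infty}x_i(t)=\sum_{k=1}^N\omega_k\bar{x}_k,\qquad \lim_{t\to\infty}v_i(t)=0,$$ where $\omega=[\omega_1,\dots,\omega_N]^T$ is the left eigenvector of the Laplacian $L$ of $\mathcal{G}$ associated with the zero eigenvalue, normalized so that $\sum_{k=1}^N\omega_k=1$.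
   Context: A directed graph $\mathcal{G}=(\mathcal{V},\mathcal{E},\mathcal{A})$ has node set $\mathcal{V}=\{1,\dots,N\}$, edge set $\mathcal{E}\subseteq\mathcal{V}\times\mathcal{V}$, and adjacency matrix $\mathcal{A}=[a_{ij}]\in\mathbb{R}^{N\times N}$ with $a_{ij}>0$ if $(j,i)\in\mathcal{E}$ and $a_{ij}=0$ otherwise. The neighbor set of agent $i$ is $\mathcal{N}_i=\{j\in\mathcal{V}:(j,i)\in\mathcal{E}\}$. The in-degree of $i$ is $d_i=\sum_{j=1}^N a_{ij}$, and the Laplacian is $L=\mathrm{diag}\{d_1,\dots,d_N\}-\mathcal{A}$. The graph is strongly connected if there is a directed path between any two distinct nodes (in each direction). For a strongly connected graph, $0$ is a simple eigenvalue of $L$ with right eigenvector $[1,\dots,1]^T$ and with a unique left eigenvector $\omega$ ($\omega^TL=0$) satisfying $\sum_{i=1}^N\omega_i=1$; its entries $\omega_i$ are positive real numbers. The symbol $N$ denotes the number of agents, while $N(\cdot)$ with an argument denotes the function $N(k)=k^2\cos(k)$, which is an even smooth Nussbaum-type function, i.e. $\limsup_{k\to\infty}\frac1k\int_0^kN(\tau)d\tau=+\infty$ and $\liminf_{k\to\infty}\frac1k\int_0^kN(\tau)d\tau=-\infty$. The closed loop is the autonomous system of ordinary differential equations in the variables $x_i,v_i,w_i,\hat{\theta}_i,\zeta_i$ ($i=1,\dots,N$), where $w_i(t)=\int_0^t\sum_{j\in\mathcal{N}_i}a_{ij}(x_i(\tau)-x_j(\tau))d\tau$ (so $w_i(0)=0$)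 and $z_i=x_i-\bar{x}_i+\rho w_i$. "Unknown" constants are those not used in the controller. *)

theory Defs
  imports "HOL-Analysis.Analysis"
begin

text \<open>
  The agents are the elements of a finite type \<open>'n\<close>; \<open>N = CARD('n)\<close>.  A pair \<open>(j, i)\<close> in the edge
  relation is an edge from \<open>j\<close> to \<open>i\<close>, so that \<open>j\<close> is a neighbor of \<open>i\<close> and \<open>A $ i $ j\<close> is its
  weight.  Self-loops are allowed.
\<close>

definition adjacency_matrix :: "('n \<times> 'n) set \<Rightarrow> real^'n^'n \<Rightarrow> bool" where
  "adjacency_matrix E A \<longleftrightarrow>
     (\<forall>i j. ((j, i) \<in> E \<longrightarrow> A $ i $ j > 0) \<and> ((j, i) \<notin> E \<longrightarrow> A $ i $ j = 0))"

definition neighbors :: "('n \<times> 'n) set \<Rightarrow> 'n \<Rightarrow> 'n set" where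
  "neighbors E i = {j. (j, i) \<in> E}"

definition strongly_connected :: "('n \<times> 'n) set \<Rightarrow> bool" where
  "strongly_connected E \<longleftrightarrow> (\<forall>i j. i \<noteq> j \<longrightarrow> (i, j) \<in> E\<^sup>+)"

definition in_degree :: "real^'n^'n \<Rightarrow> 'n \<Rightarrow> real" where
  "in_degree A i = (\<Sum>j\<in>UNIV. A $ i $ j)"

definition laplacian :: "real^'n^'n \<Rightarrow> real^'n^'n" where
  "laplacian A = (\<chi> i j. if i = j then in_degree A i else 0) - A"

text \<open>
  \<open>Ck k f\<close>: all iterated directional derivatives of \<open>f\<close> up to order \<open>k\<close> exist and are continuous,
  those of order less than \<open>k\<close> being Frechet differentiable.  On Euclidean spaces this is the usual
  class of \<open>k\<close> times continuously differentiable functions.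
\<close>

primrec Ck :: "nat \<Rightarrow> ('a::real_normed_vector \<Rightarrow> 'b::real_normed_vector) \<Rightarrow> bool" where
  "Ck 0 f \<longleftrightarrow> continuous_on UNIV f"
| "Ck (Suc k) f \<longleftrightarrow>
     (\<forall>p. f differentiable at p) \<and> (\<forall>h. Ck k (\<lambda>p. frechet_derivative f (at p) h))"

definition smooth :: "('a::real_normed_vector \<Rightarrow> 'b::real_normed_vector) \<Rightarrow> bool" where
  "smooth f \<longleftrightarrow> (\<forall>k. Ck k f)"

text \<open>
  Vectors whose dimension \<open>l\<close> depends on the agent are functions on \<open>nat\<close> of which only the entries
  below \<open>l\<close> are ever used.
\<close>

definition dot :: "nat \<Rightarrow> (nat \<Rightarrow> real) \<Rightarrow> (nat \<Rightarrow> real) \<Rightarrow> real" where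
  "dot l a b = (\<Sum>k<l. a k * b k)"

definition nussbaum :: "real \<Rightarrow> real" where
  "nussbaum k = k\<^sup>2 * cos k"

text \<open>
  Below, \<open>x i t\<close>, \<open>v i t\<close>, \<open>\<theta>h i k t\<close>, \<open>\<zeta> i t\<close> are the values at time \<open>t\<close> of the signals of agent \<open>i\<close>.
  With \<open>y = x\<close> the following is \<open>\<xi>\<^sub>i\<close>; with \<open>y = v\<close> it is the relative velocity term of the controller.
\<close>

definition disagreement ::
    "('n \<times> 'n) set \<Rightarrow> real^'n^'n \<Rightarrow> ('n \<Rightarrow> real \<Rightarrow> real) \<Rightarrow> 'n \<Rightarrow> real \<Rightarrow> real" where
  "disagreement E A y i t = (\<Sum>j\<in>neighbors E i. A $ i $ j * (y i t - y j t))"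

definition integral_term ::
    "('n \<times> 'n) set \<Rightarrow> real^'n^'n \<Rightarrow> ('n \<Rightarrow> real \<Rightarrow> real) \<Rightarrow> 'n \<Rightarrow> real \<Rightarrow> real" where
  "integral_term E A x i t = integral {0..t} (disagreement E A x i)"

definition z_signal ::
    "('n \<times> 'n) set \<Rightarrow> real^'n^'n \<Rightarrow> real \<Rightarrow> ('n \<Rightarrow> real) \<Rightarrow>
     ('n \<Rightarrow> real \<Rightarrow> real) \<Rightarrow> 'n \<Rightarrow> real \<Rightarrow> real" where
  "z_signal E A \<rho> xbar x i t = x i t - xbar i + \<rho> * integral_term E A x i t"

text \<open>
  Along a solution, \<open>v i t + \<rho> * disagreement E A x i t\<close> is the time derivative of
  \<open>z_signal E A \<rho> xbar x i\<close>.
\<close>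

definition s_signal ::
    "('n \<times> 'n) set \<Rightarrow> real^'n^'n \<Rightarrow> real \<Rightarrow> real \<Rightarrow> ('n \<Rightarrow> real) \<Rightarrow>
     ('n \<Rightarrow> real \<Rightarrow> real) \<Rightarrow> ('n \<Rightarrow> real \<Rightarrow> real) \<Rightarrow> 'n \<Rightarrow> real \<Rightarrow> real" where
  "s_signal E A \<rho> lam xbar x v i t =
     v i t + \<rho> * disagreement E A x i t + lam * z_signal E A \<rho> xbar x i t"

text \<open>The part of the bracket in the control law that also occurs in the law for \<open>\<zeta>\<close>.\<close>

definition feedback ::
    "('n \<times> 'n) set \<Rightarrow> real^'n^'n \<Rightarrow> ('n \<Rightarrow> nat) \<Rightarrow> ('n \<Rightarrow> real \<times> real \<Rightarrow> nat \<Rightarrow> real) \<Rightarrow>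
     real \<Rightarrow> real \<Rightarrow> ('n \<Rightarrow> real \<Rightarrow> real) \<Rightarrow> ('n \<Rightarrow> real \<Rightarrow> real) \<Rightarrow> ('n \<Rightarrow> nat \<Rightarrow> real \<Rightarrow> real) \<Rightarrow>
     'n \<Rightarrow> real \<Rightarrow> real" where
  "feedback E A l \<phi> \<rho> lam x v \<theta>h i t =
     dot (l i) (\<lambda>k. \<theta>h i k t) (\<phi> i (x i t, v i t)) + lam * v i t
     + \<rho> * disagreement E A v i t + lam * \<rho> * disagreement E A x i t"

definition control ::
    "('n \<times> 'n) set \<Rightarrow> real^'n^'n \<Rightarrow> ('n \<Rightarrow> nat) \<Rightarrow> ('n \<Rightarrow> real \<times> real \<Rightarrow> nat \<Rightarrow> real) \<Rightarrow>
     real \<Rightarrow> real \<Rightarrow> real \<Rightarrow> ('n \<Rightarrow> real) \<Rightarrow>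
     ('n \<Rightarrow> real \<Rightarrow> real) \<Rightarrow> ('n \<Rightarrow> real \<Rightarrow> real) \<Rightarrow> ('n \<Rightarrow> nat \<Rightarrow> real \<Rightarrow> real) \<Rightarrow> ('n \<Rightarrow> real \<Rightarrow> real) \<Rightarrow>
     'n \<Rightarrow> real \<Rightarrow> real" where
  "control E A l \<phi> \<rho> lam \<nu> xbar x v \<theta>h \<zeta> i t =
     nussbaum (\<zeta> i t) *
       (feedback E A l \<phi> \<rho> lam x v \<theta>h i t + \<nu> * s_signal E A \<rho> lam xbar x v i t)"

text \<open>Solutions of the closed loop on \<open>[0, \<infinity>)\<close>, with one-sided derivatives at time \<open>0\<close>.\<close>

definition closed_loop ::
    "('n \<times> 'n) set \<Rightarrow> real^'n^'n \<Rightarrow> ('n \<Rightarrow> nat) \<Rightarrow> ('n \<Rightarrow> real \<times> real \<Rightarrow> nat \<Rightarrow> real) \<Rightarrow>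
     ('n \<Rightarrow> real) \<Rightarrow> ('n \<Rightarrow> nat \<Rightarrow> real) \<Rightarrow>
     real \<Rightarrow> real \<Rightarrow> real \<Rightarrow> ('n \<Rightarrow> real) \<Rightarrow> ('n \<Rightarrow> real) \<Rightarrow>
     ('n \<Rightarrow> real \<Rightarrow> real) \<Rightarrow> ('n \<Rightarrow> real \<Rightarrow> real) \<Rightarrow> ('n \<Rightarrow> nat \<Rightarrow> real \<Rightarrow> real) \<Rightarrow> ('n \<Rightarrow> real \<Rightarrow> real) \<Rightarrow>
     bool" where
  "closed_loop E A l \<phi> b \<theta> \<rho> lam \<nu> \<gamma> xbar x v \<theta>h \<zeta> \<longleftrightarrow>
     (\<forall>i. \<forall>t\<ge>0.
        (x i has_real_derivative v i t) (at t within {0..}) \<and>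
        (v i has_real_derivative
           b i * control E A l \<phi> \<rho> lam \<nu> xbar x v \<theta>h \<zeta> i t
           + dot (l i) (\<theta> i) (\<phi> i (x i t, v i t))) (at t within {0..}) \<and>
        (\<forall>k<l i. (\<theta>h i k has_real_derivative
           \<gamma> i * \<phi> i (x i t, v i t) k * s_signal E A \<rho> lam xbar x v i t) (at t within {0..})) \<and>
        (\<zeta> i has_real_derivative
           \<nu> * (s_signal E A \<rho> lam xbar x v i t)\<^sup>2
           + s_signal E A \<rho> lam xbar x v i t * feedback E A l \<phi> \<rho> lam x v \<theta>h i t)
          (at t within {0..}))"

definition initial_conditions ::
    "('n \<Rightarrow> nat) \<Rightarrow> ('n \<Rightarrow> real) \<Rightarrow> ('n \<Rightarrow> real) \<Rightarrow> ('n \<Rightarrow> nat \<Rightarrow> real) \<Rightarrow> ('n \<Rightarrow> real) \<Rightarrow>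
     ('n \<Rightarrow> real \<Rightarrow> real) \<Rightarrow> ('n \<Rightarrow> real \<Rightarrow> real) \<Rightarrow> ('n \<Rightarrow> nat \<Rightarrow> real \<Rightarrow> real) \<Rightarrow> ('n \<Rightarrow> real \<Rightarrow> real) \<Rightarrow>
     bool" where
  "initial_conditions l x0 v0 \<theta>0 \<zeta>0 x v \<theta>h \<zeta> \<longleftrightarrow>
     (\<forall>i. x i 0 = x0 i \<and> v i 0 = v0 i \<and> (\<forall>k<l i. \<theta>h i k 0 = \<theta>0 i k) \<and> \<zeta> i 0 = \<zeta>0 i)"

end

theory Submission
  imports Defs "HOL-Probability.Discrete_Topology"
begin

text \<open>
  With \<open>V\<^sub>i = s\<^sub>i\<^sup>2 / 2 + |\<theta>h\<^sub>i - \<theta>\<^sub>i|\<^sup>2 / (2 \<gamma>\<^sub>i)\<close> one finds \<open>V\<^sub>i' = (b\<^sub>i N(\<zeta>\<^sub>i) + 1) \<zeta>\<^sub>i' - \<nu> s\<^sub>i\<^sup>2\<close>, so \<open>V\<^sub>i\<close> is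
  at most a constant plus \<open>P(\<zeta>\<^sub>i)\<close>, where \<open>P\<close> is a primitive of \<open>b\<^sub>i N + 1\<close>.  As \<open>P\<close> is arbitrarily negative on
  both sides of \<open>\<zeta>\<^sub>i(0)\<close> while \<open>V\<^sub>i\<close> is nonnegative, \<open>\<zeta>\<^sub>i\<close> is trapped in an interval that depends on the
  initial data only; hence \<open>s\<^sub>i\<close> and \<open>\<theta>h\<^sub>i\<close> are bounded, \<open>s\<^sub>i\<close> is square integrable, and \<open>z\<^sub>i' = s\<^sub>i - \<lambda> z\<^sub>i\<close>
  bounds \<open>z\<^sub>i\<close>.  The error \<open>e = x - z - target\<close> obeys \<open>e' = - \<rho> L (e + z)\<close> and is orthogonal to \<open>\<omega>\<close>; on
  that hyperplane \<open>\<Sum>\<^sub>i \<bar>\<omega>\<^sub>i\<bar> e\<^sub>i\<^sup>2\<close> decays exponentially up to a term controlled by \<open>z\<close>.  All these bounds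
  are uniform in the length of the existence interval, so solutions are global.  Barbalat's lemma
  gives \<open>s \<longlongrightarrow> 0\<close>, whence \<open>z \<longlongrightarrow> 0\<close> and \<open>e \<longlongrightarrow> 0\<close>.
\<close>

section \<open>Locally Lipschitz vector fields and global solutions\<close>

text \<open>Lipschitz on every box, in the l1 distance of the components in \<open>I\<close>. Other
  components do not enter the bound, so for finite \<open>I\<close> such an \<open>f\<close> depends
  on the components in \<open>I\<close> only.\<close>

definition locally_lipschitz :: "'k set \<Rightarrow> (('k \<Rightarrow> real) \<Rightarrow> real) \<Rightarrow> bool" where
  "locally_lipschitz I f \<longleftrightarrow> (\<forall>R. \<exists>K. \<forall>y y'. (\<forall>k\<in>I. \<bar>y k\<bar> \<le> R \<and> \<bar>y' k\<bar> \<le> R) \<longrightarrow>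
     \<bar>f y - f y'\<bar> \<le> K * (\<Sum>k\<in>I. \<bar>y k - y' k\<bar>))"

lemma locally_lipschitzE:
  assumes "locally_lipschitz I f"
  obtains K M where "0 \<le> K"
    and "\<And>y y'. \<forall>k\<in>I. \<bar>y k\<bar> \<le> R \<Longrightarrow> \<forall>k\<in>I. \<bar>y' k\<bar> \<le> R \<Longrightarrow>
      \<bar>f y - f y'\<bar> \<le> K * (\<Sum>k\<in>I. \<bar>y k - y' k\<bar>)"
    and "\<And>y. \<forall>k\<in>I. \<bar>y k\<bar> \<le> R \<Longrightarrow> \<bar>f y\<bar> \<le> M"
proof -
  \<comment> \<open>\<open>R\<close> may be negative. The box of size \<open>\<bar>R\<bar>\<close>
    contains the origin, and comparing \<open>f y\<close> with the value there yields the bound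
    \<open>M\<close>.\<close>
  obtain K where K: "\<And>y y'. (\<And>k. k \<in> I \<Longrightarrow> \<bar>y k\<bar> \<le> \<bar>R\<bar>) \<Longrightarrow> (\<And>k. k \<in> I \<Longrightarrow> \<bar>y' k\<bar> \<le> \<bar>R\<bar>) \<Longrightarrow>
      \<bar>f y - f y'\<bar> \<le> K * (\<Sum>k\<in>I. \<bar>y k - y' k\<bar>)"
    using assms unfolding locally_lipschitz_def by metis
  have lip: "\<bar>f y - f y'\<bar> \<le> \<bar>K\<bar> * (\<Sum>k\<in>I. \<bar>y k - y' k\<bar>)"
    if "\<And>k. k \<in> I \<Longrightarrow> \<bar>y k\<bar> \<le> \<bar>R\<bar>" "\<And>k. k \<in> I \<Longrightarrow> \<bar>y' k\<bar> \<le> \<bar>R\<bar>" for y y'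
  proof -
    have "K * (\<Sum>k\<in>I. \<bar>y k - y' k\<bar>) \<le> \<bar>K\<bar> * (\<Sum>k\<in>I. \<bar>y k - y' k\<bar>)"
      by (intro mult_right_mono) (auto intro: sum_nonneg)
    moreover have "\<bar>f y - f y'\<bar> \<le> K * (\<Sum>k\<in>I. \<bar>y k - y' k\<bar>)"
      by (rule K) (use that in auto)
    ultimately show ?thesis by linarith
  qed
  show ?thesis
  proof (rule that[of "\<bar>K\<bar>" "\<bar>f (\<lambda>_. 0)\<bar> + \<bar>K\<bar> * (of_nat (card I) * \<bar>R\<bar>)"])
    show "\<bar>f y - f y'\<bar> \<le> \<bar>K\<bar> * (\<Sum>k\<in>I. \<bar>y k - y' k\<bar>)"
      if "\<forall>k\<in>I. \<bar>y k\<bar> \<le> R" "\<forall>k\<in>I. \<bar>y' k\<bar> \<le> R" for y y'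
      by (rule lip) (use that in fastforce)+
    show "\<bar>f y\<bar> \<le> \<bar>f (\<lambda>_. 0)\<bar> + \<bar>K\<bar> * (of_nat (card I) * \<bar>R\<bar>)"
      if *: "\<forall>k\<in>I. \<bar>y k\<bar> \<le> R" for y
    proof -
      have 1: "\<bar>y k\<bar> \<le> \<bar>R\<bar>" if "k \<in> I" for k using * that by fastforce
      have "\<bar>f y - f (\<lambda>_. 0)\<bar> \<le> \<bar>K\<bar> * (\<Sum>k\<in>I. \<bar>y k - 0\<bar>)"
        by (rule lip) (use 1 in auto)
      also have "\<dots> \<le> \<bar>K\<bar> * (of_nat (card I) * \<bar>R\<bar>)"
        by (intro mult_left_mono sum_bounded_above) (use 1 in auto)
      finally show ?thesis by linarith
    qed
  qed auto
qed

lemma locally_lipschitz_bounded: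
  assumes "locally_lipschitz I f"
  shows "\<exists>M. \<forall>y. (\<forall>k\<in>I. \<bar>y k\<bar> \<le> R) \<longrightarrow> \<bar>f y\<bar> \<le> M"
  using locally_lipschitzE[OF assms, of R] by metis

section \<open>Closure properties of local Lipschitz continuity\<close>

lemma locally_lipschitz_const [simp, intro]: "locally_lipschitz I (\<lambda>y. c)"
  unfolding locally_lipschitz_def by (auto intro!: exI[of _ 0])

lemma locally_lipschitz_component [intro]:
  assumes "finite I" "k \<in> I" shows "locally_lipschitz I (\<lambda>y. y k)"
  unfolding locally_lipschitz_def
proof (intro allI exI[of _ 1] impI)
  fix y y' :: "'a \<Rightarrow> real"
  show "\<bar>y k - y' k\<bar> \<le> 1 * (\<Sum>k\<in>I. \<bar>y k - y' k\<bar>)"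
    using member_le_sum[of k I "\<lambda>k. \<bar>y k - y' k\<bar>"] assms by simp
qed

lemma locally_lipschitz_add [intro]:
  assumes "locally_lipschitz I f" "locally_lipschitz I g"
  shows "locally_lipschitz I (\<lambda>y. f y + g y)"
  unfolding locally_lipschitz_def
proof
  fix R
  obtain K where K: "\<And>y y'. \<forall>k\<in>I. \<bar>y k\<bar> \<le> R \<Longrightarrow> \<forall>k\<in>I. \<bar>y' k\<bar> \<le> R \<Longrightarrow>
      \<bar>f y - f y'\<bar> \<le> K * (\<Sum>k\<in>I. \<bar>y k - y' k\<bar>)"
    using locally_lipschitzE[OF assms(1), of R] by metis
  obtain K' where K': "\<And>y y'. \<forall>k\<in>I. \<bar>y k\<bar> \<le> R \<Longrightarrow> \<forall>k\<in>I. \<bar>y' k\<bar> \<le> R \<Longrightarrow>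
      \<bar>g y - g y'\<bar> \<le> K' * (\<Sum>k\<in>I. \<bar>y k - y' k\<bar>)"
    using locally_lipschitzE[OF assms(2), of R] by metis
  show "\<exists>K. \<forall>y y'. (\<forall>k\<in>I. \<bar>y k\<bar> \<le> R \<and> \<bar>y' k\<bar> \<le> R) \<longrightarrow>
     \<bar>(f y + g y) - (f y' + g y')\<bar> \<le> K * (\<Sum>k\<in>I. \<bar>y k - y' k\<bar>)"
  proof (intro exI[of _ "K + K'"] allI impI)
    fix y y' assume *: "\<forall>k\<in>I. \<bar>y k\<bar> \<le> R \<and> \<bar>y' k\<bar> \<le> R"
    show "\<bar>(f y + g y) - (f y' + g y')\<bar> \<le> (K + K') * (\<Sum>k\<in>I. \<bar>y k - y' k\<bar>)"
      using K[of y y'] K'[of y y'] * unfolding distrib_right by fastforce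
  qed
qed

lemma locally_lipschitz_mult [intro]:
  assumes "locally_lipschitz I f" "locally_lipschitz I g"
  shows "locally_lipschitz I (\<lambda>y. f y * g y)"
  unfolding locally_lipschitz_def
proof
  fix R
  obtain K M where K: "\<And>y y'. \<forall>k\<in>I. \<bar>y k\<bar> \<le> R \<Longrightarrow> \<forall>k\<in>I. \<bar>y' k\<bar> \<le> R \<Longrightarrow>
      \<bar>f y - f y'\<bar> \<le> K * (\<Sum>k\<in>I. \<bar>y k - y' k\<bar>)"
    and M: "\<And>y. \<forall>k\<in>I. \<bar>y k\<bar> \<le> R \<Longrightarrow> \<bar>f y\<bar> \<le> M"
    using locally_lipschitzE[OF assms(1), of R] by metis
  obtain K' M' where K': "\<And>y y'. \<forall>k\<in>I. \<bar>y k\<bar> \<le> R \<Longrightarrow> \<forall>k\<in>I. \<bar>y' k\<bar> \<le> R \<Longrightarrow>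
      \<bar>g y - g y'\<bar> \<le> K' * (\<Sum>k\<in>I. \<bar>y k - y' k\<bar>)"
    and M': "\<And>y. \<forall>k\<in>I. \<bar>y k\<bar> \<le> R \<Longrightarrow> \<bar>g y\<bar> \<le> M'"
    using locally_lipschitzE[OF assms(2), of R] by metis
  show "\<exists>K. \<forall>y y'. (\<forall>k\<in>I. \<bar>y k\<bar> \<le> R \<and> \<bar>y' k\<bar> \<le> R) \<longrightarrow>
     \<bar>f y * g y - f y' * g y'\<bar> \<le> K * (\<Sum>k\<in>I. \<bar>y k - y' k\<bar>)"
  proof (intro exI[of _ "M * K' + K * M'"] allI impI)
    fix y y' assume *: "\<forall>k\<in>I. \<bar>y k\<bar> \<le> R \<and> \<bar>y' k\<bar> \<le> R"
    let ?S = "\<Sum>k\<in>I. \<bar>y k - y' k\<bar>"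
    have "f y * g y - f y' * g y' = f y * (g y - g y') + (f y - f y') * g y'"
      by (simp add: algebra_simps)
    also have "\<bar>\<dots>\<bar> \<le> \<bar>f y\<bar> * \<bar>g y - g y'\<bar> + \<bar>f y - f y'\<bar> * \<bar>g y'\<bar>"
      by (metis abs_mult abs_triangle_ineq)
    also have "\<dots> \<le> M * (K' * ?S) + (K * ?S) * M'"
    proof (intro add_mono mult_mono)
      show "\<bar>f y\<bar> \<le> M" "\<bar>g y'\<bar> \<le> M'" using M M' * by auto
      then show "0 \<le> M" by linarith
      show "\<bar>g y - g y'\<bar> \<le> K' * ?S" "\<bar>f y - f y'\<bar> \<le> K * ?S" using K K' * by auto
      then show "0 \<le> K * ?S" by linarith
    qed auto
    finally show "\<bar>f y * g y - f y' * g y'\<bar> \<le> (M * K' + K * M') * ?S"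
      by (simp add: algebra_simps)
  qed
qed

lemma locally_lipschitz_diff [intro]:
  assumes "locally_lipschitz I f" "locally_lipschitz I g"
  shows "locally_lipschitz I (\<lambda>y. f y - g y)"
proof -
  have "locally_lipschitz I (\<lambda>y. f y + (-1) * g y)"
    using assms by (intro locally_lipschitz_add locally_lipschitz_mult locally_lipschitz_const)
  then show ?thesis by simp
qed

lemma locally_lipschitz_power [intro]:
  assumes "locally_lipschitz I f"
  shows "locally_lipschitz I (\<lambda>y. f y ^ n)"
  by (induction n) (use assms in \<open>simp_all add: locally_lipschitz_mult\<close>)

lemma locally_lipschitz_sum [intro]:
  assumes "\<And>a. a \<in> S \<Longrightarrow> locally_lipschitz I (f a)"
  shows "locally_lipschitz I (\<lambda>y. \<Sum>a\<in>S. f a y)"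
  using assms by (induction S rule: infinite_finite_induct) (simp_all add: locally_lipschitz_add)

lemma locally_lipschitz_cos [intro]:
  assumes "locally_lipschitz I f"
  shows "locally_lipschitz I (\<lambda>y. cos (f y))"
  unfolding locally_lipschitz_def
proof
  fix R
  obtain K where K: "\<And>y y'. \<forall>k\<in>I. \<bar>y k\<bar> \<le> R \<Longrightarrow> \<forall>k\<in>I. \<bar>y' k\<bar> \<le> R \<Longrightarrow>
      \<bar>f y - f y'\<bar> \<le> K * (\<Sum>k\<in>I. \<bar>y k - y' k\<bar>)"
    using locally_lipschitzE[OF assms(1), of R] by metis
  have "\<bar>cos a - cos c\<bar> \<le> \<bar>a - c\<bar>" for a c :: real
  proof -
    have "norm (cos a - cos c) \<le> 1 * norm (a - c)"
      by (rule field_differentiable_bound[of UNIV cos "\<lambda>x. - sin x"])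
        (auto intro!: derivative_eq_intros)
    then show ?thesis by simp
  qed
  then show "\<exists>K. \<forall>y y'. (\<forall>k\<in>I. \<bar>y k\<bar> \<le> R \<and> \<bar>y' k\<bar> \<le> R) \<longrightarrow>
     \<bar>cos (f y) - cos (f y')\<bar> \<le> K * (\<Sum>k\<in>I. \<bar>y k - y' k\<bar>)"
    using K by (intro exI[of _ K]) (meson order_trans)
qed

text \<open>The weight \<open>exp (- \<alpha> t)\<close> makes the Picard operator a contraction on all of \<open>[0, \<infinity>)\<close> at once.
  Paths are bounded continuous functions of the component index, which carries the discrete topology,
  and of time.\<close>

lemma lipschitz_ode_global_solution:
  fixes g :: "'k \<Rightarrow> ('k \<Rightarrow> real) \<Rightarrow> real" and y0 :: "'k \<Rightarrow> real"
  assumes fin: "finite I"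
    and lip: "\<And>k y y'. k \<in> I \<Longrightarrow> \<bar>g k y - g k y'\<bar> \<le> K * (\<Sum>j\<in>I. \<bar>y j - y' j\<bar>)"
    and bd: "\<And>k y. k \<in> I \<Longrightarrow> \<bar>g k y\<bar> \<le> G"
  shows "\<exists>y. \<forall>k\<in>I. y k 0 = y0 k \<and>
    (\<forall>t\<ge>0. (y k has_real_derivative g k (\<lambda>j. y j t)) (at t within {0..}))"
proof -
  \<comment> \<open>\<open>C\<close> is a Lipschitz constant for the maximum norm, the summand 1
    keeping it positive. The rate of the weight is twice \<open>C\<close>, so that the contraction
    factor C / \<alpha> is 1/2.\<close>
  define C where "C = \<bar>K\<bar> * card I + 1"
  define \<alpha> where "\<alpha> = 2 * C"
  have C: "C > 0" and \<alpha>: "\<alpha> > 0" unfolding \<alpha>_def C_def by (auto intro: add_nonneg_pos)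
  have lipd: "\<bar>g k y - g k y'\<bar> \<le> C * d"
    if k: "k \<in> I" and d: "\<And>j. j \<in> I \<Longrightarrow> \<bar>y j - y' j\<bar> \<le> d" "0 \<le> d" for k y y' d
  proof -
    have "\<bar>g k y - g k y'\<bar> \<le> \<bar>K\<bar> * (\<Sum>j\<in>I. \<bar>y j - y' j\<bar>)"
      by (rule order_trans[OF lip[OF k] mult_right_mono]) (auto intro: sum_nonneg)
    also have "\<dots> \<le> \<bar>K\<bar> * (card I * d)"
      by (intro mult_left_mono sum_bounded_above) (use d in auto)
    also have "\<dots> \<le> C * d" unfolding C_def using d by (simp add: algebra_simps)
    finally show ?thesis .
  qed
  have cont_g: "continuous_on UNIV (\<lambda>\<sigma>. g k (p \<sigma>))"
    if k: "k \<in> I" and p: "\<And>j. continuous_on UNIV (\<lambda>\<sigma>. p \<sigma> j)" for k and p :: "real \<Rightarrow> 'k \<Rightarrow> real"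
  proof -
    have "((\<lambda>\<sigma>. g k (p \<sigma>)) \<longlongrightarrow> g k (p \<sigma>0)) (at \<sigma>0)" for \<sigma>0
    proof (rule LIM_zero_cancel, rule Lim_null_comparison)
      show "\<forall>\<^sub>F \<sigma> in at \<sigma>0. norm (g k (p \<sigma>) - g k (p \<sigma>0)) \<le> K * (\<Sum>j\<in>I. \<bar>p \<sigma> j - p \<sigma>0 j\<bar>)"
        using lip[OF k] by simp
      have "((\<lambda>\<sigma>. p \<sigma> j) \<longlongrightarrow> p \<sigma>0 j) (at \<sigma>0)" for j
        using p[of j] by (simp add: continuous_on_eq_continuous_within isCont_def)
      then have "((\<lambda>\<sigma>. K * (\<Sum>j\<in>I. \<bar>p \<sigma> j - p \<sigma>0 j\<bar>)) \<longlongrightarrow> K * (\<Sum>j\<in>I. \<bar>p \<sigma>0 j - p \<sigma>0 j\<bar>)) (at \<sigma>0)"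
        by (intro tendsto_intros)
      then show "((\<lambda>\<sigma>. K * (\<Sum>j\<in>I. \<bar>p \<sigma> j - p \<sigma>0 j\<bar>)) \<longlongrightarrow> 0) (at \<sigma>0)" by simp
    qed
    then show ?thesis by (simp add: continuous_on_eq_continuous_within isCont_def)
  qed
  \<comment> \<open>The unknown \<open>u\<close> is the path multiplied by exp (- \<alpha> t), which
    stays bounded while the path itself may grow; \<open>path\<close> removes the weight.\<close>
  define path :: "(('k discrete \<times> real) \<Rightarrow>\<^sub>C real) \<Rightarrow> real \<Rightarrow> 'k \<Rightarrow> real"
    where "path u \<sigma> j = exp (\<alpha> * \<sigma>) * apply_bcontfun u (discrete j, \<sigma>)" for u \<sigma> j
  have cont_path: "continuous_on UNIV (\<lambda>\<sigma>. g k (path u \<sigma>))" if "k \<in> I" for k u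
  proof (rule cont_g[OF that])
    fix j
    have "continuous_on UNIV (apply_bcontfun u \<circ> (\<lambda>\<sigma>. (discrete j, \<sigma>)))"
      by (intro continuous_on_compose continuous_intros) auto
    then show "continuous_on UNIV (\<lambda>\<sigma>. path u \<sigma> j)"
      unfolding path_def by (intro continuous_intros) (simp add: o_def)
  qed
  have intg: "(\<lambda>\<sigma>. g k (path u \<sigma>)) integrable_on {0..\<tau>}" if "k \<in> I" for k u \<tau>
    by (intro integrable_continuous_real continuous_on_subset[OF cont_path[OF that]]) auto
  define J where "J u k \<tau> = integral {0..\<tau>} (\<lambda>\<sigma>. g k (path u \<sigma>))" for u k \<tau>
  have J_deriv: "((\<lambda>\<tau>. J u k \<tau>) has_real_derivative g k (path u t)) (at t within {0..})"
    if "k \<in> I" "t \<ge> 0" for u k t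
  proof -
    have "((\<lambda>\<tau>. J u k \<tau>) has_real_derivative g k (path u t)) (at t within {0..t+1})"
      unfolding J_def
      by (intro integral_has_real_derivative continuous_on_subset[OF cont_path[OF that(1)]])
        (use that in auto)
    \<comment> \<open>The integral is differentiated on a compact interval, which coincides with the
      half-line near \<open>t\<close>.\<close>
    moreover have "at t within {0..t+1} = at t within {0..}"
      by (rule at_within_nhd[of _ "{..<t+1}"]) (use that in auto)
    ultimately show ?thesis by simp
  qed
  \<comment> \<open>The weighted Picard operator. Bounded continuous functions live on the whole
    real line, so negative times get the value at 0, and indices outside \<open>I\<close> get
    0.\<close>
  define \<Phi>0 :: "(('k discrete \<times> real) \<Rightarrow>\<^sub>C real) \<Rightarrow> 'k discrete \<times> real \<Rightarrow> real"
    where "\<Phi>0 u p = (let k = of_discrete (fst p); \<tau> = max 0 (snd p) in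
      if k \<in> I then exp (- \<alpha> * \<tau>) * (y0 k + J u k \<tau>) else 0)" for u p
  \<comment> \<open>As \<open>g\<close> is bounded, the integral in the Picard operator grows at
    most linearly in time; this inequality lets the weight absorb that growth.\<close>
  have exp_ge: "\<tau> * exp (- \<alpha> * \<tau>) \<le> 1 / \<alpha>" for \<tau>
  proof -
    have "\<alpha> * \<tau> \<le> exp (\<alpha> * \<tau>)" using exp_ge_add_one_self[of "\<alpha> * \<tau>"] by linarith
    then show ?thesis using \<alpha> by (simp add: exp_minus divide_simps mult.commute)
  qed
  have \<Phi>0_in: "\<Phi>0 u \<in> bcontfun" for u
  proof (rule bcontfun_normI)
    have cont_k: "continuous_on UNIV (\<lambda>t. \<Phi>0 u (discrete k, t))" for k
    proof (cases "k \<in> I")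
      case True
      have "continuous_on {0..} (J u k)"
        using J_deriv[OF True] by (intro DERIV_continuous_on) auto
      then have "continuous_on UNIV (J u k \<circ> (\<lambda>t. max 0 t))"
        by (intro continuous_on_compose continuous_intros) (auto elim: continuous_on_subset)
      then have "continuous_on UNIV (\<lambda>t. exp (- \<alpha> * max 0 t) * (y0 k + J u k (max 0 t)))"
        by (intro continuous_intros) (simp add: o_def)
      then show ?thesis using True by (simp add: \<Phi>0_def Let_def discrete_inverse)
    qed (simp add: \<Phi>0_def Let_def discrete_inverse)
    \<comment> \<open>In the discrete topology every slice of constant index is open, so continuity
      in time on each slice suffices.\<close>
    have "continuous_on ({k} \<times> UNIV) (\<Phi>0 u)" for k :: "'k discrete"
    proof -
      have "continuous_on ({k} \<times> UNIV) ((\<lambda>t. \<Phi>0 u (discrete (of_discrete k), t)) \<circ> snd)"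
        by (intro continuous_on_compose continuous_on_subset[OF cont_k[of "of_discrete k"]] continuous_intros) auto
      then show ?thesis
        by (rule continuous_on_eq) (auto simp: of_discrete_inverse)
    qed
    then have "continuous_on (\<Union>k\<in>UNIV. {k} \<times> UNIV) (\<Phi>0 u)"
      by (intro continuous_on_open_UN open_Times open_discrete) auto
    moreover have "(\<Union>k\<in>UNIV. {k} \<times> UNIV) = (UNIV :: ('k discrete \<times> real) set)" by auto
    ultimately show "continuous_on UNIV (\<Phi>0 u)" by simp
    fix p :: "'k discrete \<times> real"
    let ?k = "of_discrete (fst p)" and ?\<tau> = "max 0 (snd p)"
    show "norm (\<Phi>0 u p) \<le> (\<Sum>k\<in>I. \<bar>y0 k\<bar>) + \<bar>G\<bar> / \<alpha>"
    proof (cases "?k \<in> I")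
      case True
      have "norm (integral {0..?\<tau>} (\<lambda>\<sigma>. g ?k (path u \<sigma>))) \<le> \<bar>G\<bar> * (?\<tau> - 0)"
        by (rule integral_bound)
          (auto intro!: continuous_on_subset[OF cont_path[OF True]] order_trans[OF bd[OF True]])
      then have "\<bar>J u ?k ?\<tau>\<bar> \<le> \<bar>G\<bar> * ?\<tau>" by (simp add: J_def)
      then have "\<bar>exp (- \<alpha> * ?\<tau>) * J u ?k ?\<tau>\<bar> \<le> exp (- \<alpha> * ?\<tau>) * (\<bar>G\<bar> * ?\<tau>)"
        by (simp only: abs_mult abs_exp_cancel) (intro mult_left_mono, auto)
      also have "\<dots> = \<bar>G\<bar> * (?\<tau> * exp (- \<alpha> * ?\<tau>))" by simp
      also have "\<dots> \<le> \<bar>G\<bar> * (1 / \<alpha>)" by (intro mult_left_mono exp_ge) auto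
      finally have 1: "\<bar>exp (- \<alpha> * ?\<tau>) * J u ?k ?\<tau>\<bar> \<le> \<bar>G\<bar> / \<alpha>" by simp
      have "\<bar>exp (- \<alpha> * ?\<tau>) * y0 ?k\<bar> \<le> 1 * \<bar>y0 ?k\<bar>"
        by (simp only: abs_mult abs_exp_cancel) (intro mult_right_mono, use \<alpha> in auto)
      also have "\<dots> \<le> (\<Sum>k\<in>I. \<bar>y0 k\<bar>)"
        using member_le_sum[of ?k I "\<lambda>k. \<bar>y0 k\<bar>"] True fin by simp
      finally have 2: "\<bar>exp (- \<alpha> * ?\<tau>) * y0 ?k\<bar> \<le> (\<Sum>k\<in>I. \<bar>y0 k\<bar>)" .
      show ?thesis using abs_triangle_ineq[THEN order_trans, OF add_mono[OF 2 1]] True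
        by (simp add: \<Phi>0_def Let_def distrib_left)
    qed (use \<alpha> in \<open>auto simp: \<Phi>0_def Let_def intro!: add_nonneg_nonneg sum_nonneg\<close>)
  qed
  define \<Phi> where "\<Phi> u = Bcontfun (\<Phi>0 u)" for u
  have app_\<Phi>: "apply_bcontfun (\<Phi> u) = \<Phi>0 u" for u
    unfolding \<Phi>_def using \<Phi>0_in by (simp add: Bcontfun_inverse)
  have "dist (\<Phi> u) (\<Phi> u') \<le> 1/2 * dist u u'" for u u'
  proof (rule dist_bound)
    fix p :: "'k discrete \<times> real"
    let ?k = "of_discrete (fst p)" and ?\<tau> = "max 0 (snd p)" and ?d = "dist u u'"
    show "dist (apply_bcontfun (\<Phi> u) p) (apply_bcontfun (\<Phi> u') p) \<le> 1/2 * ?d"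
    proof (cases "?k \<in> I")
      case True
      \<comment> \<open>The integral of exp (\<alpha> \<sigma>) up to \<tau> is at most exp
        (\<alpha> \<tau>) / \<alpha>. The outer weight cancels the exponential, and the factor C /
        \<alpha> remains.\<close>
      have int: "((\<lambda>\<sigma>. C * (exp (\<alpha> * \<sigma>) * ?d)) has_integral
          (C * (exp (\<alpha> * ?\<tau>) * ?d) / \<alpha> - C * (exp (\<alpha> * 0) * ?d) / \<alpha>)) {0..?\<tau>}"
        by (rule fundamental_theorem_of_calculus)
          (use \<alpha> in \<open>auto intro!: derivative_eq_intros simp flip: has_real_derivative_iff_has_vector_derivative\<close>)
      have "\<bar>J u ?k ?\<tau> - J u' ?k ?\<tau>\<bar> =
        \<bar>integral {0..?\<tau>} (\<lambda>\<sigma>. g ?k (path u \<sigma>) - g ?k (path u' \<sigma>))\<bar>"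
        unfolding J_def by (subst integral_diff) (use intg[OF True] in auto)
      also have "\<dots> \<le> integral {0..?\<tau>} (\<lambda>\<sigma>. C * (exp (\<alpha> * \<sigma>) * ?d))"
      proof -
        have "norm (integral {0..?\<tau>} (\<lambda>\<sigma>. g ?k (path u \<sigma>) - g ?k (path u' \<sigma>)))
          \<le> integral {0..?\<tau>} (\<lambda>\<sigma>. C * (exp (\<alpha> * \<sigma>) * ?d))"
        proof (rule integral_norm_bound_integral)
          show "(\<lambda>\<sigma>. g ?k (path u \<sigma>) - g ?k (path u' \<sigma>)) integrable_on {0..?\<tau>}"
            by (intro integrable_diff intg True)
          show "(\<lambda>\<sigma>. C * (exp (\<alpha> * \<sigma>) * ?d)) integrable_on {0..?\<tau>}"
            by (intro integrable_continuous_real continuous_intros)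
          fix \<sigma>
          have "\<bar>path u \<sigma> j - path u' \<sigma> j\<bar> \<le> exp (\<alpha> * \<sigma>) * ?d" for j
            using dist_bounded[of u "(discrete j, \<sigma>)" u']
            by (simp add: path_def dist_real_def abs_mult flip: right_diff_distrib)
          then show "norm (g ?k (path u \<sigma>) - g ?k (path u' \<sigma>)) \<le> C * (exp (\<alpha> * \<sigma>) * ?d)"
            using lipd[OF True] by simp
        qed
        then show ?thesis by simp
      qed
      also have "integral {0..?\<tau>} (\<lambda>\<sigma>. C * (exp (\<alpha> * \<sigma>) * ?d)) =
          C * (exp (\<alpha> * ?\<tau>) * ?d) / \<alpha> - C * (exp (\<alpha> * 0) * ?d) / \<alpha>"
        by (rule integral_unique[OF int])
      also have "\<dots> \<le> C * (exp (\<alpha> * ?\<tau>) * ?d) / \<alpha>" using C \<alpha> by simp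
      finally have *: "\<bar>J u ?k ?\<tau> - J u' ?k ?\<tau>\<bar> \<le> exp (\<alpha> * ?\<tau>) * (1/2 * ?d)"
        using C by (simp add: \<alpha>_def)
      have "dist (apply_bcontfun (\<Phi> u) p) (apply_bcontfun (\<Phi> u') p)
          = exp (- \<alpha> * ?\<tau>) * \<bar>J u ?k ?\<tau> - J u' ?k ?\<tau>\<bar>"
        using True by (simp add: app_\<Phi> \<Phi>0_def Let_def dist_real_def abs_mult flip: right_diff_distrib)
      also have "\<dots> \<le> exp (- \<alpha> * ?\<tau>) * (exp (\<alpha> * ?\<tau>) * (1/2 * ?d))"
        using * by (intro mult_left_mono) auto
      also have "\<dots> = 1/2 * ?d"
        by (simp flip: mult.assoc exp_add)
      finally show ?thesis .
    qed (simp add: app_\<Phi> \<Phi>0_def Let_def)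
  qed
  then have "\<exists>!u. \<Phi> u = u"
    by (intro banach_fix_type[of "1/2"]) auto
  then obtain u where u: "\<Phi> u = u" by blast
  define y where "y k t = y0 k + J u k t" for k t
  have path_y: "path u t k = y k t" if "k \<in> I" "t \<ge> 0" for k t
  proof -
    have "apply_bcontfun u (discrete k, t) = exp (- \<alpha> * t) * y k t"
      using app_\<Phi>[of u] u that by (simp add: \<Phi>0_def Let_def discrete_inverse y_def)
    then show ?thesis by (simp add: path_def flip: mult.assoc exp_add)
  qed
  show ?thesis
  proof (intro exI[of _ y] ballI conjI allI impI)
    fix k assume k: "k \<in> I"
    show "y k 0 = y0 k" by (simp add: y_def J_def)
    fix t :: real assume t: "t \<ge> 0"
    \<comment> \<open>\<open>path u t\<close> and the values of \<open>y\<close> are known to agree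
      on \<open>I\<close> only; the Lipschitz bound shows that \<open>g k\<close> sees no other
      components.\<close>
    have "\<bar>g k (path u t) - g k (\<lambda>j. y j t)\<bar> \<le> K * (\<Sum>j\<in>I. \<bar>path u t j - y j t\<bar>)"
      by (rule lip[OF k])
    then have "g k (path u t) = g k (\<lambda>j. y j t)" using t by (simp add: path_y)
    moreover have "(y k has_real_derivative g k (path u t)) (at t within {0..})"
      unfolding y_def [abs_def] by (auto intro!: derivative_eq_intros J_deriv k t)
    ultimately show "(y k has_real_derivative g k (\<lambda>j. y j t)) (at t within {0..})"
      by simp
  qed
qed

text \<open>Clamping every component to a box makes the field bounded and globally Lipschitz, so the
  clamped system has a global solution. The bound \<open>B\<close>, which is independent of
  \<open>T\<close>, keeps this solution inside the box, where both fields agree.\<close>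

theorem ode_global_solution:
  fixes f :: "'k \<Rightarrow> ('k \<Rightarrow> real) \<Rightarrow> real" and y0 :: "'k \<Rightarrow> real"
  assumes fin: "finite I"
    and lip: "\<And>k. k \<in> I \<Longrightarrow> locally_lipschitz I (f k)"
    and a_priori: "\<And>T y k. T \<ge> 0 \<Longrightarrow> (\<And>k. k \<in> I \<Longrightarrow> y k 0 = y0 k) \<Longrightarrow>
      (\<And>k t. k \<in> I \<Longrightarrow> t \<in> {0..T} \<Longrightarrow>
        (y k has_real_derivative f k (\<lambda>j. y j t)) (at t within {0..T})) \<Longrightarrow>
      k \<in> I \<Longrightarrow> \<bar>y k T\<bar> \<le> B"
  shows "\<exists>y. \<forall>k\<in>I. y k 0 = y0 k \<and>
    (\<forall>t\<ge>0. (y k has_real_derivative f k (\<lambda>j. y j t)) (at t within {0..}))"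
proof -
  \<comment> \<open>The box is strictly larger than the a priori bound, so that reaching its
    boundary is contradictory, and it contains the initial values.\<close>
  define R where "R = \<bar>B\<bar> + (\<Sum>k\<in>I. \<bar>y0 k\<bar>) + 1"
  have "0 \<le> (\<Sum>k\<in>I. \<bar>y0 k\<bar>)" by (simp add: sum_nonneg)
  then have BR: "B < R" and R0: "R > 0" unfolding R_def by linarith+
  define cl :: "('k \<Rightarrow> real) \<Rightarrow> 'k \<Rightarrow> real" where "cl y k = max (- R) (min R (y k))" for y k
  have cl_bd: "\<bar>cl y k\<bar> \<le> R" for y k unfolding cl_def using R0 by auto
  have cl_lip: "\<bar>cl y k - cl y' k\<bar> \<le> \<bar>y k - y' k\<bar>" for y y' k unfolding cl_def by auto
  have cl_id: "cl y k = y k" if "\<bar>y k\<bar> \<le> R" for y k using that unfolding cl_def by auto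
  have "\<forall>k\<in>I. \<exists>K M. 0 \<le> K \<and> (\<forall>y y'. \<bar>f k (cl y) - f k (cl y')\<bar> \<le> K * (\<Sum>k\<in>I. \<bar>y k - y' k\<bar>)) \<and> (\<forall>y. \<bar>f k (cl y)\<bar> \<le> M)"
  proof
    fix k assume "k \<in> I"
    obtain K M where K: "0 \<le> K" "\<And>y y'. \<forall>k\<in>I. \<bar>y k\<bar> \<le> R \<Longrightarrow> \<forall>k\<in>I. \<bar>y' k\<bar> \<le> R \<Longrightarrow>
      \<bar>f k y - f k y'\<bar> \<le> K * (\<Sum>k\<in>I. \<bar>y k - y' k\<bar>)"
      and M: "\<And>y. \<forall>k\<in>I. \<bar>y k\<bar> \<le> R \<Longrightarrow> \<bar>f k y\<bar> \<le> M"
      by (rule locally_lipschitzE[OF lip[OF \<open>k \<in> I\<close>], of R]) (rule that)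
    have "\<bar>f k (cl y) - f k (cl y')\<bar> \<le> K * (\<Sum>k\<in>I. \<bar>y k - y' k\<bar>)" for y y'
    proof -
      have "\<bar>f k (cl y) - f k (cl y')\<bar> \<le> K * (\<Sum>k\<in>I. \<bar>cl y k - cl y' k\<bar>)"
        by (intro K ballI cl_bd)
      also have "\<dots> \<le> K * (\<Sum>k\<in>I. \<bar>y k - y' k\<bar>)"
        by (intro mult_left_mono sum_mono cl_lip K)
      finally show ?thesis .
    qed
    then show "\<exists>K M. 0 \<le> K \<and> (\<forall>y y'. \<bar>f k (cl y) - f k (cl y')\<bar> \<le> K * (\<Sum>k\<in>I. \<bar>y k - y' k\<bar>)) \<and> (\<forall>y. \<bar>f k (cl y)\<bar> \<le> M)"
      using M K(1) cl_bd by (intro exI[of _ K] exI[of _ M]) auto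
  qed
  then obtain K M where K: "\<And>k. k \<in> I \<Longrightarrow> 0 \<le> K k"
      "\<And>k y y'. k \<in> I \<Longrightarrow> \<bar>f k (cl y) - f k (cl y')\<bar> \<le> K k * (\<Sum>k\<in>I. \<bar>y k - y' k\<bar>)"
    and M: "\<And>k y. k \<in> I \<Longrightarrow> \<bar>f k (cl y)\<bar> \<le> M k"
    by metis
  have "\<exists>y. \<forall>k\<in>I. y k 0 = y0 k \<and>
    (\<forall>t\<ge>0. (y k has_real_derivative f k (cl (\<lambda>j. y j t))) (at t within {0..}))"
  proof (rule lipschitz_ode_global_solution[OF fin])
    fix k y y' assume k: "k \<in> I"
    have "K k \<le> (\<Sum>k\<in>I. K k)" using member_le_sum[of k I K] k fin K by simp
    then have "K k * (\<Sum>k\<in>I. \<bar>y k - y' k\<bar>) \<le> (\<Sum>k\<in>I. K k) * (\<Sum>k\<in>I. \<bar>y k - y' k\<bar>)"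
      by (intro mult_right_mono) (auto intro: sum_nonneg)
    then show "\<bar>f k (cl y) - f k (cl y')\<bar> \<le> (\<Sum>k\<in>I. K k) * (\<Sum>k\<in>I. \<bar>y k - y' k\<bar>)"
      using K(2)[OF k, of y y'] by linarith
    show "\<bar>f k (cl y)\<bar> \<le> (\<Sum>k\<in>I. \<bar>M k\<bar>)"
      using M[OF k, of y] member_le_sum[of k I "\<lambda>k. \<bar>M k\<bar>"] k fin by simp
  qed
  then obtain y where y0: "\<And>k. k \<in> I \<Longrightarrow> y k 0 = y0 k"
    and y: "\<And>k t. k \<in> I \<Longrightarrow> t \<ge> 0 \<Longrightarrow>
      (y k has_real_derivative f k (cl (\<lambda>j. y j t))) (at t within {0..})"
    by blast
  \<comment> \<open>Clamping may also alter components outside \<open>I\<close>; the Lipschitz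
    estimate, whose right-hand side is 0 here, shows that \<open>f k\<close> does not
    notice.\<close>
  have f_cl: "f k (cl z) = f k z" if k: "k \<in> I" and z: "\<And>j. j \<in> I \<Longrightarrow> \<bar>z j\<bar> \<le> R" for k z
  proof -
    obtain L where "\<bar>f k (cl z) - f k z\<bar> \<le> L * (\<Sum>j\<in>I. \<bar>cl z j - z j\<bar>)"
      using lip[OF k] z cl_bd unfolding locally_lipschitz_def by metis
    moreover have "(\<Sum>j\<in>I. \<bar>cl z j - z j\<bar>) = 0" using z by (simp add: cl_id)
    ultimately show ?thesis by simp
  qed
  have y_cont: "continuous_on {0..} (y k)" if "k \<in> I" for k
    using y[OF that] by (intro DERIV_continuous_on) auto
  text \<open>As long as the solution of the truncated system stays in the box it solves the original
    system, so by the a priori bound it cannot reach the boundary of the box.\<close>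
  have inside: "\<bar>y k t\<bar> < R" if kt: "k \<in> I" "t \<ge> 0" for k t
  proof (rule ccontr)
    assume "\<not> \<bar>y k t\<bar> < R"
    \<comment> \<open>\<open>S\<close> collects the times at which some component is on or beyond
      the boundary of the box. It is closed, so its infimum \<open>T\<close> is the first such
      time.\<close>
    define S where "S = (\<Union>k\<in>I. {t \<in> {0..}. R \<le> \<bar>y k t\<bar>})"
    have "t \<in> S" using \<open>\<not> \<bar>y k t\<bar> < R\<close> kt by (auto simp: S_def not_less)
    have "closed {t \<in> {0..}. R \<le> \<bar>y k t\<bar>}" if "k \<in> I" for k
    proof -
      have "closed ({0..} \<inter> (\<lambda>t. \<bar>y k t\<bar>) -` {R..})"
        by (intro continuous_closed_preimage continuous_intros y_cont that closed_atLeast)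
      moreover have "{0..} \<inter> (\<lambda>t. \<bar>y k t\<bar>) -` {R..} = {t \<in> {0..}. R \<le> \<bar>y k t\<bar>}" by auto
      ultimately show ?thesis by simp
    qed
    then have "closed S" unfolding S_def using fin by auto
    define T where "T = Inf S"
    have bb: "bdd_below S" by (rule bdd_belowI[of _ 0]) (auto simp: S_def)
    have "T \<in> S" unfolding T_def using \<open>closed S\<close> \<open>t \<in> S\<close> bb
      by (intro closed_contains_Inf) auto
    then obtain j where j: "j \<in> I" "R \<le> \<bar>y j T\<bar>" and T0: "T \<ge> 0" by (auto simp: S_def)
    have before: "\<bar>y k \<tau>\<bar> < R" if "k \<in> I" "0 \<le> \<tau>" "\<tau> < T" for k \<tau>
    proof (rule ccontr)
      assume "\<not> \<bar>y k \<tau>\<bar> < R"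
      then have "\<tau> \<in> S" using that by (auto simp: S_def not_less)
      then have "T \<le> \<tau>" unfolding T_def using bb by (rule cInf_lower)
      then show False using that by simp
    qed
    \<comment> \<open>The strict bound before \<open>T\<close> becomes a weak one at
      \<open>T\<close> by continuity. If \<open>T = 0\<close> there is no earlier time, and the
      choice of \<open>R\<close> is used instead.\<close>
    have le_R: "\<bar>y k \<tau>\<bar> \<le> R" if k: "k \<in> I" and \<tau>: "\<tau> \<in> {0..T}" for k \<tau>
    proof (cases "T = 0")
      case True
      then show ?thesis
        using \<tau> y0[OF k] member_le_sum[of k I "\<lambda>k. \<bar>y0 k\<bar>"] k fin by (simp add: R_def)
    next
      case False
      have "continuous_on (closure {0..<T}) (y k)"
        by (intro continuous_on_subset[OF y_cont[OF k]]) (use False T0 in auto)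
      moreover have "\<tau> \<in> closure {0..<T}" using \<tau> False T0 by auto
      ultimately show ?thesis
        using continuous_on_closure_norm_le[of "{0..<T}" "y k" R \<tau>] before[OF k] by fastforce
    qed
    have "\<bar>y j T\<bar> \<le> B"
    proof (rule a_priori[of T y j])
      fix k \<tau> assume k: "k \<in> I" and \<tau>: "\<tau> \<in> {0..T}"
      have "(y k has_real_derivative f k (cl (\<lambda>j. y j \<tau>))) (at \<tau> within {0..T})"
        by (rule DERIV_subset[OF y[OF k]]) (use \<tau> in auto)
      then show "(y k has_real_derivative f k (\<lambda>j. y j \<tau>)) (at \<tau> within {0..T})"
        using f_cl[OF k, of "\<lambda>j. y j \<tau>"] le_R[OF _ \<tau>] by simp
    qed (use T0 y0 j in auto)
    then show False using j BR by linarith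
  qed
  show ?thesis
  proof (intro exI[of _ y] ballI conjI allI impI y0)
    fix k t assume k: "k \<in> I" and t: "(0::real) \<le> t"
    show "(y k has_real_derivative f k (\<lambda>j. y j t)) (at t within {0..})"
      using y[OF k t] f_cl[OF k, of "\<lambda>j. y j t"] inside[OF _ t] by (simp add: less_imp_le)
  qed
qed

text \<open>Mean value inequality on a convex compact box: the two partial derivatives are
  continuous, hence bounded there, and their bounds add up to a bound on the operator norm of the
  derivative.\<close>

lemma locally_lipschitz_smooth:
  fixes F :: "real \<times> real \<Rightarrow> real"
  assumes I: "finite I" "a \<in> I" "c \<in> I" and F: "smooth F"
  shows "locally_lipschitz I (\<lambda>y. F (y a, y c))"
  unfolding locally_lipschitz_def
proof
  fix R :: real
  let ?S = "cbox (- R, - R) (R, R) :: (real \<times> real) set"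
  have "Ck (Suc 0) F" using F unfolding smooth_def by blast
  then have diff: "\<And>p. F differentiable at p"
    and cont: "\<And>h. continuous_on UNIV (\<lambda>p. frechet_derivative F (at p) h)" by auto
  define D where "D p = frechet_derivative F (at p)" for p
  have D: "(F has_derivative D p) (at p)" for p
    unfolding D_def using diff by (simp add: frechet_derivative_works)
  have "\<exists>M. \<forall>p\<in>?S. \<bar>D p h\<bar> \<le> M" for h
  proof -
    have "compact ((\<lambda>p. D p h) ` ?S)"
      unfolding D_def by (intro compact_continuous_image continuous_on_subset[OF cont]) auto
    then show ?thesis by (auto dest!: compact_imp_bounded simp: bounded_iff)
  qed
  then obtain M1 M2 where M: "\<And>p. p \<in> ?S \<Longrightarrow> \<bar>D p (1, 0)\<bar> \<le> M1" "\<And>p. p \<in> ?S \<Longrightarrow> \<bar>D p (0, 1)\<bar> \<le> M2"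
    by meson
  have lip: "\<bar>F p - F q\<bar> \<le> (M1 + M2) * norm (p - q)" if pq: "p \<in> ?S" "q \<in> ?S" for p q
  proof -
    have "norm (F p - F q) \<le> (M1 + M2) * norm (p - q)"
    proof (rule differentiable_bound[of ?S F D])
      show "convex ?S" by (rule convex_box)
      show "(F has_derivative D p) (at p within ?S)" for p
        using D by (rule has_derivative_at_withinI)
      show "onorm (D p) \<le> M1 + M2" if p: "p \<in> ?S" for p
      proof (rule onorm_le)
        fix h :: "real \<times> real"
        obtain h1 h2 where h: "h = (h1, h2)" by (cases h)
        interpret bounded_linear "D p" using D by (rule has_derivative_bounded_linear)
        have "h = h1 *\<^sub>R (1, 0) + h2 *\<^sub>R (0, 1)" by (simp add: h)
        then have "D p h = h1 * D p (1, 0) + h2 * D p (0, 1)" by (simp only: add scaleR) simp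
        also have "\<bar>\<dots>\<bar> \<le> \<bar>h1\<bar> * \<bar>D p (1, 0)\<bar> + \<bar>h2\<bar> * \<bar>D p (0, 1)\<bar>"
          by (metis abs_mult abs_triangle_ineq)
        also have "\<dots> \<le> norm h * M1 + norm h * M2"
          using M[OF p] norm_fst_le[of h1 h2] norm_snd_le[of h2 h1]
          by (intro add_mono mult_mono) (auto simp: h)
        finally show "norm (D p h) \<le> (M1 + M2) * norm h" by (simp add: algebra_simps)
      qed
    qed (use pq in auto)
    then show ?thesis by simp
  qed
  show "\<exists>K. \<forall>y y'. (\<forall>k\<in>I. \<bar>y k\<bar> \<le> R \<and> \<bar>y' k\<bar> \<le> R) \<longrightarrow>
     \<bar>F (y a, y c) - F (y' a, y' c)\<bar> \<le> K * (\<Sum>k\<in>I. \<bar>y k - y' k\<bar>)"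
  \<comment> \<open>\<open>a\<close> and \<open>c\<close> may coincide, so each of the two
    increments is estimated by the full sum; hence the factor 2.\<close>
  proof (intro exI[of _ "(M1 + M2) * 2"] allI impI)
    fix y y' assume *: "\<forall>k\<in>I. \<bar>y k\<bar> \<le> R \<and> \<bar>y' k\<bar> \<le> R"
    then have S: "(y a, y c) \<in> ?S" "(y' a, y' c) \<in> ?S" using I
      by (auto simp: mem_box Basis_prod_def abs_le_iff minus_le_iff)
    have M0: "0 \<le> M1 + M2" using M[OF S(1)] by linarith
    have "norm ((y a, y c) - (y' a, y' c)) \<le> \<bar>y a - y' a\<bar> + \<bar>y c - y' c\<bar>"
      using norm_Pair_le[of "y a - y' a" "y c - y' c"] by simp
    also have "\<dots> \<le> 2 * (\<Sum>k\<in>I. \<bar>y k - y' k\<bar>)"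
      using member_le_sum[of a I "\<lambda>k. \<bar>y k - y' k\<bar>"] member_le_sum[of c I "\<lambda>k. \<bar>y k - y' k\<bar>"] I
      by simp
    finally have "(M1 + M2) * norm ((y a, y c) - (y' a, y' c)) \<le> (M1 + M2) * (2 * (\<Sum>k\<in>I. \<bar>y k - y' k\<bar>))"
      using M0 by (rule mult_left_mono)
    then show "\<bar>F (y a, y c) - F (y' a, y' c)\<bar> \<le> (M1 + M2) * 2 * (\<Sum>k\<in>I. \<bar>y k - y' k\<bar>)"
      using lip[OF S] unfolding mult.assoc by linarith
  qed
qed

section \<open>Differential inequalities and Barbalat's lemma\<close>

lemma nonincreasing_on_interval:
  fixes f :: "real \<Rightarrow> real"
  assumes "a \<le> b"
    and d: "\<And>t. t \<in> {a..b} \<Longrightarrow> (f has_real_derivative f' t) (at t within {a..b})"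
    and neg: "\<And>t. t \<in> {a..b} \<Longrightarrow> f' t \<le> 0"
  shows "f b \<le> f a"
proof (rule DERIV_nonpos_imp_decreasing_open[OF \<open>a \<le> b\<close>])
  show "continuous_on {a..b} f" using d by (rule DERIV_continuous_on)
  fix t assume t: "a < t" "t < b"
  then have "(f has_real_derivative f' t) (at t)"
    using d[of t] by (simp add: at_within_Icc_at)
  then show "\<exists>y. (f has_real_derivative y) (at t) \<and> y \<le> 0" using neg[of t] t by auto
qed

text \<open>Integrating factor: the differential inequality makes
  \<open>(u t - M / \<kappa>) * exp (\<kappa> * t)\<close> nonincreasing.\<close>

lemma exponential_decay_bound:
  fixes u :: "real \<Rightarrow> real"
  assumes "a \<le> b" and \<kappa>: "\<kappa> > 0"
    and d: "\<And>t. t \<in> {a..b} \<Longrightarrow> (u has_real_derivative u' t) (at t within {a..b})"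
    and le: "\<And>t. t \<in> {a..b} \<Longrightarrow> u' t \<le> - \<kappa> * u t + M"
  shows "u b \<le> M / \<kappa> + (u a - M / \<kappa>) * exp (- \<kappa> * (b - a))"
proof -
  have "(u b - M / \<kappa>) * exp (\<kappa> * b) \<le> (u a - M / \<kappa>) * exp (\<kappa> * a)"
  proof (rule nonincreasing_on_interval[OF \<open>a \<le> b\<close>])
    fix t assume t: "t \<in> {a..b}"
    show "((\<lambda>t. (u t - M / \<kappa>) * exp (\<kappa> * t)) has_real_derivative
        (u' t + \<kappa> * u t - M) * exp (\<kappa> * t)) (at t within {a..b})"
      using \<kappa> by (auto intro!: derivative_eq_intros d[OF t] simp: field_simps)
    show "(u' t + \<kappa> * u t - M) * exp (\<kappa> * t) \<le> 0"
      using le[OF t] by (intro mult_nonpos_nonneg) auto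
  qed
  then have "(u b - M / \<kappa>) * exp (\<kappa> * b) * exp (- \<kappa> * b) \<le> (u a - M / \<kappa>) * exp (\<kappa> * a) * exp (- \<kappa> * b)"
    by (rule mult_right_mono) simp
  moreover have "exp (\<kappa> * b) * exp (- \<kappa> * b) = 1" "exp (\<kappa> * a) * exp (- \<kappa> * b) = exp (- \<kappa> * (b - a))"
    by (simp_all add: algebra_simps flip: exp_add)
  ultimately show ?thesis by (simp only: mult.assoc) simp
qed

text \<open>The exponential bound is a convex combination of \<open>u a\<close> and
  \<open>M / \<kappa>\<close>. The maximum does not mention the length of the interval, which is
  what makes the later bounds uniform in time.\<close>

lemma exponential_decay_le_max:
  fixes u :: "real \<Rightarrow> real"
  assumes "a \<le> b" and \<kappa>: "\<kappa> > 0"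
    and d: "\<And>t. t \<in> {a..b} \<Longrightarrow> (u has_real_derivative u' t) (at t within {a..b})"
    and le: "\<And>t. t \<in> {a..b} \<Longrightarrow> u' t \<le> - \<kappa> * u t + M"
  shows "u b \<le> max (u a) (M / \<kappa>)"
proof -
  let ?x = "exp (- \<kappa> * (b - a))"
  have x: "0 \<le> ?x" "?x \<le> 1" using \<open>a \<le> b\<close> \<kappa> by auto
  have "u b \<le> M / \<kappa> + (u a - M / \<kappa>) * ?x"
    by (rule exponential_decay_bound[OF assms])
  also have "\<dots> = (1 - ?x) * (M / \<kappa>) + ?x * u a" by (simp add: algebra_simps)
  also have "\<dots> \<le> (1 - ?x) * max (u a) (M / \<kappa>) + ?x * max (u a) (M / \<kappa>)"
    using x by (intro add_mono mult_left_mono) auto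
  finally show ?thesis by (simp add: algebra_simps)
qed

text \<open>Once the forcing \<open>h\<close> is below \<open>\<kappa> * \<epsilon> / 2\<close>, the
  exponential bound restarted at that time leaves \<epsilon> / 2 plus a term that tends to
  0.\<close>

lemma exponential_decay_tendsto_0:
  fixes u :: "real \<Rightarrow> real"
  assumes \<kappa>: "\<kappa> > 0"
    and d: "\<And>t. t \<ge> 0 \<Longrightarrow> (u has_real_derivative u' t) (at t within {0..})"
    and le: "\<And>t. t \<ge> 0 \<Longrightarrow> u' t \<le> - \<kappa> * u t + h t"
    and h: "(h \<longlongrightarrow> 0) at_top" and u: "\<And>t. t \<ge> 0 \<Longrightarrow> 0 \<le> u t"
  shows "(u \<longlongrightarrow> 0) at_top"
proof (rule tendstoI)
  fix \<epsilon> :: real assume \<epsilon>: "\<epsilon> > 0"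
  have "\<forall>\<^sub>F t in at_top. h t < \<kappa> * \<epsilon> / 2" using h \<kappa> \<epsilon> by (intro order_tendstoD(2)) auto
  then obtain T0 where T0: "\<And>t. t \<ge> T0 \<Longrightarrow> h t < \<kappa> * \<epsilon> / 2"
    unfolding eventually_at_top_linorder by blast
  define T where "T = max 0 T0"
  have T: "T \<ge> 0" "T \<ge> T0" unfolding T_def by auto
  have bound: "u t \<le> \<epsilon> / 2 + (u T - \<epsilon> / 2) * exp (- \<kappa> * (t - T))" if t: "t \<ge> T" for t
  proof -
    have "u t \<le> (\<kappa> * \<epsilon> / 2) / \<kappa> + (u T - (\<kappa> * \<epsilon> / 2) / \<kappa>) * exp (- \<kappa> * (t - T))"
    proof (rule exponential_decay_bound[OF t \<kappa>])
      fix s assume s: "s \<in> {T..t}"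
      show "(u has_real_derivative u' s) (at s within {T..t})"
        by (rule DERIV_subset[OF d]) (use s T in auto)
      show "u' s \<le> - \<kappa> * u s + \<kappa> * \<epsilon> / 2" using le[of s] T0[of s] s T by auto
    qed
    then show ?thesis using \<kappa> by simp
  qed
  have "((\<lambda>t. \<epsilon> / 2 + (u T - \<epsilon> / 2) * exp (- \<kappa> * (t - T))) \<longlongrightarrow> \<epsilon> / 2 + (u T - \<epsilon> / 2) * 0) at_top"
  proof (intro tendsto_intros)
    have "filterlim (\<lambda>t. \<kappa> * (- T + t)) at_top at_top"
      by (intro filterlim_tendsto_pos_mult_at_top[OF tendsto_const \<kappa>]
          filterlim_tendsto_add_at_top[OF tendsto_const filterlim_ident])
    then have "filterlim (\<lambda>t. \<kappa> * (t - T)) at_top at_top" by simp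
    then have "filterlim (\<lambda>t. - \<kappa> * (t - T)) at_bot at_top"
      by (simp add: filterlim_uminus_at_bot)
    then show "((\<lambda>t. exp (- \<kappa> * (t - T))) \<longlongrightarrow> 0) at_top"
      by (rule filterlim_compose[OF exp_at_bot])
  qed
  then have "\<forall>\<^sub>F t in at_top. \<epsilon> / 2 + (u T - \<epsilon> / 2) * exp (- \<kappa> * (t - T)) < \<epsilon>"
    by (rule order_tendstoD(2)) (use \<epsilon> in auto)
  moreover have "\<forall>\<^sub>F t in at_top. t \<ge> T" by (rule eventually_ge_at_top)
  ultimately show "\<forall>\<^sub>F t in at_top. dist (u t) 0 < \<epsilon>"
    by eventually_elim (use bound u T in \<open>fastforce simp: dist_real_def\<close>)
qed

text \<open>A value \<open>f t \<ge> \<epsilon>\<close> persists above \<epsilon> / 2 for a time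
  \<delta>, because the slope is bounded, and so raises the primitive \<open>F\<close> by \<delta>
  \<epsilon> / 2. Late in time \<open>F\<close> is closer than that to its supremum.\<close>

lemma barbalat:
  fixes F f f' :: "real \<Rightarrow> real"
  assumes dF: "\<And>t. t \<ge> 0 \<Longrightarrow> (F has_real_derivative f t) (at t within {0..})"
    and df: "\<And>t. t \<ge> 0 \<Longrightarrow> (f has_real_derivative f' t) (at t within {0..})"
    and f: "\<And>t. t \<ge> 0 \<Longrightarrow> 0 \<le> f t" and f': "\<And>t. t \<ge> 0 \<Longrightarrow> \<bar>f' t\<bar> \<le> M"
    and F: "\<And>t. t \<ge> 0 \<Longrightarrow> F t \<le> B"
  shows "(f \<longlongrightarrow> 0) at_top"
proof (rule tendstoI)
  fix \<epsilon> :: real assume \<epsilon>: "\<epsilon> > 0"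
  have M: "M \<ge> 0" using f'[of 0] by simp
  \<comment> \<open>Chosen so that a slope of size at most \<open>M\<close> loses at most \<epsilon>
    / 2 within time \<delta>; the added 1 avoids a division by zero.\<close>
  define \<delta> where "\<delta> = \<epsilon> / (2 * (M + 1))"
  have \<delta>: "\<delta> > 0" "M * \<delta> \<le> \<epsilon> / 2"
    unfolding \<delta>_def using \<epsilon> M by (auto simp: field_simps)
  have mono: "F s \<le> F t" if "0 \<le> s" "s \<le> t" for s t
  proof -
    have "- F t \<le> - F s"
    proof (rule nonincreasing_on_interval[OF that(2)])
      fix r assume r: "r \<in> {s..t}"
      show "((\<lambda>t. - F t) has_real_derivative - f r) (at r within {s..t})"
        by (rule DERIV_minus, rule DERIV_subset[OF dF]) (use r that in auto)
      show "- f r \<le> 0" using f[of r] r that by auto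
    qed
    then show ?thesis by simp
  qed
  define L where "L = (SUP t\<in>{0..}. F t)"
  have bdd: "bdd_above (F ` {0..})" using F by (auto intro!: bdd_aboveI[of _ B])
  have "\<exists>T\<in>{0..}. L - \<delta> * (\<epsilon> / 2) < F T"
    using less_cSUP_iff[OF _ bdd, of "L - \<delta> * (\<epsilon> / 2)"] \<delta> \<epsilon> unfolding L_def by auto
  then obtain T where T: "T \<ge> 0" "L - \<delta> * (\<epsilon> / 2) < F T" by auto
  have "f t < \<epsilon>" if t: "t \<ge> T" for t
  proof (rule ccontr)
    assume "\<not> f t < \<epsilon>"
    then have ft: "f t \<ge> \<epsilon>" by simp
    have f_ge: "f r \<ge> \<epsilon> / 2" if r: "t \<le> r" "r \<le> t + \<delta>" for r
    proof -
      have "- f r - M * r \<le> - f t - M * t"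
      proof (rule nonincreasing_on_interval[OF r(1)])
        fix s assume s: "s \<in> {t..r}"
        have "(f has_real_derivative f' s) (at s within {t..r})"
          by (rule DERIV_subset[OF df]) (use s t T in auto)
        then show "((\<lambda>s. - f s - M * s) has_real_derivative - f' s - M) (at s within {t..r})"
          by (auto intro!: derivative_eq_intros)
        show "- f' s - M \<le> 0" using f'[of s] s t T by auto
      qed
      moreover have "M * (r - t) \<le> M * \<delta>" using r M by (intro mult_left_mono) auto
      ultimately show ?thesis using ft \<delta>(2) by (simp add: algebra_simps)
    qed
    have "\<epsilon> / 2 * (t + \<delta>) - F (t + \<delta>) \<le> \<epsilon> / 2 * t - F t"
    proof (rule nonincreasing_on_interval[of t "t + \<delta>"])
      show "t \<le> t + \<delta>" using \<delta> by simp
      fix s assume s: "s \<in> {t..t + \<delta>}"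
      have "(F has_real_derivative f s) (at s within {t..t+\<delta>})"
        by (rule DERIV_subset[OF dF]) (use s t T in auto)
      then show "((\<lambda>s. \<epsilon> / 2 * s - F s) has_real_derivative \<epsilon> / 2 - f s) (at s within {t..t+\<delta>})"
        by (auto intro!: derivative_eq_intros)
      show "\<epsilon> / 2 - f s \<le> 0" using f_ge[of s] s by auto
    qed
    moreover have "F (t + \<delta>) \<le> L" unfolding L_def
      by (rule cSUP_upper[OF _ bdd]) (use t T \<delta> in auto)
    moreover have "F T \<le> F t" using mono T t by auto
    moreover have "\<epsilon> / 2 * (t + \<delta>) = \<epsilon> / 2 * t + \<delta> * (\<epsilon> / 2)" by (simp add: algebra_simps)
    ultimately show False using T by linarith
  qed
  then show "\<forall>\<^sub>F t in at_top. dist (f t) 0 < \<epsilon>"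
    using f T unfolding eventually_at_top_linorder by (intro exI[of _ T]) (auto simp: dist_real_def)
qed

section \<open>The Nussbaum function\<close>

text \<open>The primitive of \<open>nussbaum\<close> that vanishes at 0, as two integrations by
  parts produce it.\<close>

definition nussbaum_integral :: "real \<Rightarrow> real" where
  "nussbaum_integral k = k\<^sup>2 * sin k + 2 * k * cos k - 2 * sin k"

lemma nussbaum_integral_deriv [derivative_intros]:
  assumes "(f has_real_derivative f') (at t within S)"
  shows "((\<lambda>t. nussbaum_integral (f t)) has_real_derivative nussbaum (f t) * f') (at t within S)"
  unfolding nussbaum_integral_def nussbaum_def
  by (rule derivative_eq_intros refl assms)+ (simp add: algebra_simps power2_eq_square)

lemma nussbaum_integral_minus: "nussbaum_integral (- k) = - nussbaum_integral k"
  by (simp add: nussbaum_integral_def)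

text \<open>At points where the cosine vanishes and the sine has the sign opposite to
  \<open>b\<close>, the first summand is \<open>- \<bar>b\<bar> * (k\<^sup>2 - 2)\<close>, a
  negative quadratic that outweighs the linear summand.\<close>

lemma nussbaum_integral_unbounded:
  assumes "b \<noteq> 0"
  shows "\<exists>k>Z. b * nussbaum_integral k + k < c"
proof -
  define r where "r = (if b > 0 then - pi / 2 else pi / 2)"
  define k where "k n = r + of_nat n * (2 * pi)" for n :: nat
  define a where "a = \<bar>b\<bar>"
  have a: "a > 0" unfolding a_def using assms by simp
  have kn: "b * nussbaum_integral (k n) = - a * ((k n)\<^sup>2 - 2)" for n
  proof -
    have "sin (k n) = sin r" "cos (k n) = cos r"
      using sin.plus_of_nat[of r n] cos.plus_of_nat[of r n] unfolding k_def by simp_all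
    then have "sin (k n) = (if b > 0 then - 1 else 1)" "cos (k n) = 0"
      unfolding r_def by auto
    then show ?thesis using assms by (auto simp: nussbaum_integral_def a_def algebra_simps)
  qed
  \<comment> \<open>The last entry makes \<open>a * k\<close> at least
    \<open>2 * a + \<bar>c\<bar> + 2\<close>, so \<open>a * k\<^sup>2 - k - 2 * a\<close> exceeds
    \<open>\<bar>c\<bar>\<close>. The extra \<open>pi\<close> below makes up for the offset
    \<open>r\<close>.\<close>
  define k0 where "k0 = max (max 1 (Z + 1)) ((2 * a + \<bar>c\<bar> + 2) / a)"
  obtain n :: nat where "(k0 + pi) / (2 * pi) \<le> of_nat n" using real_arch_simple by blast
  then have "k0 + pi \<le> of_nat n * (2 * pi)" by (simp add: field_simps)
  then have k: "k n \<ge> k0" unfolding k_def r_def using pi_gt_zero by (smt (verit) field_sum_of_halves)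
  then have k1: "k n \<ge> 1" "k n > Z" "k n \<ge> (2 * a + \<bar>c\<bar> + 2) / a" unfolding k0_def by auto
  then have "2 * a + \<bar>c\<bar> + 2 \<le> a * k n" using a by (simp add: field_simps)
  then have "(2 * a + \<bar>c\<bar> + 2) * k n \<le> a * k n * k n"
    using k1 by (intro mult_right_mono) auto
  moreover have "(2 * a + \<bar>c\<bar> + 1) * 1 \<le> (2 * a + \<bar>c\<bar> + 1) * k n"
    using k1 a by (intro mult_left_mono) auto
  ultimately have "b * nussbaum_integral (k n) + k n < c"
    unfolding kn by (simp add: algebra_simps power2_eq_square)
  then show ?thesis using k1 by blast
qed

text \<open>On each side of the initial value there is a barrier at which the required lower bound
  \<open>c\<close> fails. By the intermediate value theorem a continuous path cannot cross it. The
  barriers depend on \<open>b\<close>, \<open>c\<close> and \<open>\<zeta>0\<close> only, hence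
  \<open>K\<close> serves all \<open>T\<close> and all paths.\<close>

lemma nussbaum_confines:
  assumes b: "b \<noteq> 0"
  shows "\<exists>K. \<forall>(T :: real) \<zeta>. continuous_on {0..T} \<zeta> \<longrightarrow> \<zeta> 0 = \<zeta>0 \<longrightarrow>
     (\<forall>t\<in>{0..T}. c \<le> b * nussbaum_integral (\<zeta> t) + \<zeta> t) \<longrightarrow> (\<forall>t\<in>{0..T}. \<bar>\<zeta> t\<bar> \<le> K)"
proof -
  obtain k1 where k1: "k1 > \<bar>\<zeta>0\<bar>" "b * nussbaum_integral k1 + k1 < c"
    using nussbaum_integral_unbounded[OF b] by blast
  \<comment> \<open>The barrier on the negative side is \<open>- k2\<close>: the primitive is odd,
    which turns \<open>b\<close> into \<open>- b\<close>, and the linear summand becomes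
    \<open>- k2\<close>, which is even smaller than \<open>k2\<close>.\<close>
  obtain k2 where k2: "k2 > \<bar>\<zeta>0\<bar>" "- b * nussbaum_integral k2 + k2 < c"
    using nussbaum_integral_unbounded[of "- b"] b by auto
  show ?thesis
  proof (intro exI[of _ "max k1 k2"] allI impI ballI)
    fix T :: real and \<zeta> :: "real \<Rightarrow> real" and t
    assume cont: "continuous_on {0..T} \<zeta>" and 0: "\<zeta> 0 = \<zeta>0"
      and ge: "\<forall>t\<in>{0..T}. c \<le> b * nussbaum_integral (\<zeta> t) + \<zeta> t" and t: "t \<in> {0..T}"
    have cont': "continuous_on {0..t} \<zeta>" by (rule continuous_on_subset[OF cont]) (use t in auto)
    have "\<not> \<zeta> t > k1"
    proof
      assume "\<zeta> t > k1"
      then obtain s where "0 \<le> s" "s \<le> t" "\<zeta> s = k1"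
        using IVT'[of \<zeta> 0 k1 t] cont' 0 k1 t by force
      then show False using ge k1 t by force
    qed
    moreover have "\<not> \<zeta> t < - k2"
    proof
      assume "\<zeta> t < - k2"
      then obtain s where "0 \<le> s" "s \<le> t" "\<zeta> s = - k2"
        using IVT2'[of \<zeta> t "- k2" 0] cont' 0 k2 t by force
      moreover from this have "c \<le> b * nussbaum_integral (\<zeta> s) + \<zeta> s" using ge t by force
      ultimately show False using k2 by (simp add: nussbaum_integral_minus)
    qed
    ultimately show "\<bar>\<zeta> t\<bar> \<le> max k1 k2" by auto
  qed
qed

section \<open>The Laplacian of a strongly connected graph\<close>

text \<open>The balance form of the null condition: at each node the weighted in-degree equals the
  weighted sum over outgoing edges. In this form absolute values can be taken.\<close>

lemma left_null_vector_laplacian: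
  "\<omega> v* laplacian A = 0 \<longleftrightarrow> (\<forall>j. \<omega> $ j * in_degree A j = (\<Sum>i\<in>UNIV. \<omega> $ i * A $ i $ j))"
proof -
  have "(\<omega> v* laplacian A) $ j = \<omega> $ j * in_degree A j - (\<Sum>i\<in>UNIV. \<omega> $ i * A $ i $ j)" for j
  proof -
    have "(\<omega> v* laplacian A) $ j =
        (\<Sum>i\<in>UNIV. (if i = j then \<omega> $ i * in_degree A i else 0) - \<omega> $ i * A $ i $ j)"
      by (auto simp: vector_matrix_mult_def laplacian_def algebra_simps intro!: sum.cong)
    also have "\<dots> = \<omega> $ j * in_degree A j - (\<Sum>i\<in>UNIV. \<omega> $ i * A $ i $ j)"
      unfolding sum_subtractf by simp
    finally show ?thesis .
  qed
  then show ?thesis by (simp add: vec_eq_iff)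
qed

lemma adjacency_matrix_nonneg: "adjacency_matrix E A \<Longrightarrow> 0 \<le> A $ i $ j"
  unfolding adjacency_matrix_def by (cases "(j, i) \<in> E") (auto intro: less_imp_le)

text \<open>Perron--Frobenius: summing the triangle inequality over all columns shows that it is an
  equality in every column.\<close>

lemma abs_left_null_vector:
  assumes A: "adjacency_matrix E A" and \<omega>: "\<omega> v* laplacian A = 0"
  shows "\<bar>\<omega> $ j\<bar> * in_degree A j = (\<Sum>i\<in>UNIV. \<bar>\<omega> $ i\<bar> * A $ i $ j)"
proof -
  note nn = adjacency_matrix_nonneg[OF A]
  have deg: "0 \<le> in_degree A j" for j unfolding in_degree_def by (simp add: sum_nonneg nn)
  have le: "\<bar>\<omega> $ j\<bar> * in_degree A j \<le> (\<Sum>i\<in>UNIV. \<bar>\<omega> $ i\<bar> * A $ i $ j)" for j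
  proof -
    have "\<bar>\<omega> $ j\<bar> * in_degree A j = \<bar>\<omega> $ j * in_degree A j\<bar>" using deg by (simp add: abs_mult)
    also have "\<dots> = \<bar>\<Sum>i\<in>UNIV. \<omega> $ i * A $ i $ j\<bar>"
      using \<omega> unfolding left_null_vector_laplacian by simp
    also have "\<dots> \<le> (\<Sum>i\<in>UNIV. \<bar>\<omega> $ i * A $ i $ j\<bar>)" by (rule sum_abs)
    finally show ?thesis using nn by (simp add: abs_mult)
  qed
  have "(\<Sum>j\<in>UNIV. \<Sum>i\<in>UNIV. \<bar>\<omega> $ i\<bar> * A $ i $ j) = (\<Sum>j\<in>UNIV. \<bar>\<omega> $ j\<bar> * in_degree A j)"
    by (subst sum.swap) (simp add: in_degree_def sum_distrib_left)
  then have "(\<Sum>j\<in>UNIV. (\<Sum>i\<in>UNIV. \<bar>\<omega> $ i\<bar> * A $ i $ j) - \<bar>\<omega> $ j\<bar> * in_degree A j) = 0"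
    by (simp add: sum_subtractf)
  then have "\<forall>j\<in>UNIV. (\<Sum>i\<in>UNIV. \<bar>\<omega> $ i\<bar> * A $ i $ j) - \<bar>\<omega> $ j\<bar> * in_degree A j = 0"
    by (subst (asm) sum_nonneg_eq_0_iff) (use le in auto)
  then show ?thesis by simp
qed

text \<open>At a zero entry the balance equation for the absolute values is a vanishing sum of
  nonnegative terms, so the entry at the head of every outgoing edge is zero too. Strong
  connectivity spreads the zero to all nodes.\<close>

lemma left_null_vector_nonzero:
  assumes A: "adjacency_matrix E A" and E: "strongly_connected E"
    and \<omega>: "\<omega> v* laplacian A = 0" "\<omega> \<noteq> 0"
  shows "\<omega> $ i \<noteq> 0"
proof
  assume i: "\<omega> $ i = 0"
  have step: "\<omega> $ k = 0" if "\<omega> $ j = 0" "(j, k) \<in> E" for j k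
  proof -
    have "(\<Sum>i\<in>UNIV. \<bar>\<omega> $ i\<bar> * A $ i $ j) = 0"
      using abs_left_null_vector[OF A \<omega>(1), of j] that by simp
    then have "\<forall>i\<in>UNIV. \<bar>\<omega> $ i\<bar> * A $ i $ j = 0"
      by (subst (asm) sum_nonneg_eq_0_iff) (auto simp: adjacency_matrix_nonneg[OF A])
    then show ?thesis using that A unfolding adjacency_matrix_def by (metis abs_eq_0 mult_eq_0_iff order_less_irrefl iso_tuple_UNIV_I)
  qed
  have "\<omega> $ j = 0" for j
  proof (cases "i = j")
    case False
    then have "(i, j) \<in> E\<^sup>+" using E unfolding strongly_connected_def by blast
    then show ?thesis by (induction rule: trancl_induct) (use i step in auto)
  qed (use i in simp)
  then show False using \<omega>(2) by (simp add: vec_eq_iff)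
qed

text \<open>Expand \<open>2 * e i * (e i - e j) = (e i - e j)\<^sup>2 + (e i)\<^sup>2 - (e
  j)\<^sup>2\<close>; the balance condition on \<open>p\<close> makes the sums of the last two
  squares cancel.\<close>

lemma laplacian_quadratic_form:
  fixes A :: "real^'n::finite^'n"
  assumes p: "\<And>j. p j * in_degree A j = (\<Sum>i\<in>UNIV. p i * A $ i $ j)"
  shows "(\<Sum>i\<in>UNIV. p i * e i * (\<Sum>j\<in>UNIV. A $ i $ j * (e i - e j))) =
    (\<Sum>i\<in>UNIV. \<Sum>j\<in>UNIV. p i * A $ i $ j * (e i - e j)\<^sup>2) / 2"
proof -
  have 1: "(\<Sum>i\<in>UNIV. \<Sum>j\<in>UNIV. p i * A $ i $ j * (e i)\<^sup>2) = (\<Sum>i\<in>UNIV. p i * in_degree A i * (e i)\<^sup>2)"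
    by (simp add: in_degree_def sum_distrib_left sum_distrib_right)
  have 2: "(\<Sum>i\<in>UNIV. \<Sum>j\<in>UNIV. p i * A $ i $ j * (e j)\<^sup>2) = (\<Sum>i\<in>UNIV. p i * in_degree A i * (e i)\<^sup>2)"
    unfolding p by (subst sum.swap) (simp add: sum_distrib_right)
  have "(\<Sum>i\<in>UNIV. \<Sum>j\<in>UNIV. p i * A $ i $ j * (e i - e j)\<^sup>2) =
     (\<Sum>i\<in>UNIV. \<Sum>j\<in>UNIV. 2 * (p i * e i * (A $ i $ j * (e i - e j))) +
        (p i * A $ i $ j * (e j)\<^sup>2 - p i * A $ i $ j * (e i)\<^sup>2))"
    by (intro sum.cong refl) (simp add: power2_eq_square algebra_simps)
  also have "\<dots> = 2 * (\<Sum>i\<in>UNIV. p i * e i * (\<Sum>j\<in>UNIV. A $ i $ j * (e i - e j)))"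
    unfolding sum.distrib sum_subtractf 1 2 by (simp add: sum_distrib_left)
  finally show ?thesis by simp
qed

text \<open>Compactness: a zero of the form takes equal values across every edge, hence is constant,
  and the only constant vector in the hyperplane is 0. So the form has a positive minimum on the
  unit sphere of the hyperplane, and homogeneity extends the estimate.\<close>

lemma disagreement_form_coercive:
  fixes A :: "real^'n::finite^'n"
  assumes A: "adjacency_matrix E A" and E: "strongly_connected E"
    and p: "\<And>i. p i > 0" and \<omega>: "(\<Sum>i\<in>UNIV. \<omega> i) \<noteq> 0"
  shows "\<exists>q>0. \<forall>e. (\<Sum>i\<in>UNIV. \<omega> i * e i) = 0 \<longrightarrow>
    q * (\<Sum>i\<in>UNIV. (e i)\<^sup>2) \<le> (\<Sum>i\<in>UNIV. \<Sum>j\<in>UNIV. p i * A $ i $ j * (e i - e j)\<^sup>2)"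
proof -
  define Q :: "real^'n \<Rightarrow> real" where "Q x = (\<Sum>i\<in>UNIV. \<Sum>j\<in>UNIV. p i * A $ i $ j * (x $ i - x $ j)\<^sup>2)" for x
  define S :: "(real^'n) set" where "S = sphere 0 1 \<inter> {x. (\<Sum>i\<in>UNIV. \<omega> i * x $ i) = 0}"
  have nn: "0 \<le> p i * A $ i $ j * (x $ i - x $ j)\<^sup>2" for i j and x :: "real^'n"
    using p[of i] adjacency_matrix_nonneg[OF A, of i j] by simp
  have Q_nn: "0 \<le> Q x" for x unfolding Q_def by (intro sum_nonneg nn)
  have Q_pos: "0 < Q x" if x: "x \<in> S" for x
  proof (rule ccontr)
    assume "\<not> 0 < Q x"
    then have "Q x = 0" using Q_nn[of x] by simp
    then have "\<forall>i\<in>UNIV. (\<Sum>j\<in>UNIV. p i * A $ i $ j * (x $ i - x $ j)\<^sup>2) = 0"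
      unfolding Q_def by (subst (asm) sum_nonneg_eq_0_iff) (auto intro: sum_nonneg nn)
    then have "\<forall>j\<in>UNIV. p i * A $ i $ j * (x $ i - x $ j)\<^sup>2 = 0" for i
      by (subst (asm) sum_nonneg_eq_0_iff) (auto intro: nn)
    then have edge: "x $ i = x $ j" if "(j, i) \<in> E" for i j
      using p[of i] A that unfolding adjacency_matrix_def by (force simp: less_le)
    have const: "x $ i = x $ j" for i j
    proof (cases "j = i")
      case False
      then have "(j, i) \<in> E\<^sup>+" using E unfolding strongly_connected_def by blast
      then show ?thesis by (induction rule: trancl_induct) (use edge in auto)
    qed simp
    obtain i0 :: 'n where True by blast
    have "(\<Sum>i\<in>UNIV. \<omega> i * x $ i) = (\<Sum>i\<in>UNIV. \<omega> i) * x $ i0"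
      unfolding sum_distrib_right by (intro sum.cong refl) (metis const)
    then have "x $ i0 = 0" using x \<omega> unfolding S_def by simp
    then have "x = 0" using const by (metis vec_eq_iff zero_index)
    then show False using x unfolding S_def by simp
  qed
  have "\<exists>q>0. \<forall>x\<in>S. q \<le> Q x"
  \<comment> \<open>With a single agent the hyperplane is trivial and \<open>S\<close> is
    empty.\<close>
  proof (cases "S = {}")
    case False
    have "closed {x :: real^'n. (\<Sum>i\<in>UNIV. \<omega> i * x $ i) = 0}"
      by (intro closed_Collect_eq continuous_intros)
    then have "compact S" unfolding S_def by (intro compact_Int_closed compact_sphere)
    moreover have "continuous_on S Q" unfolding Q_def by (intro continuous_intros)
    ultimately obtain x where "x \<in> S" "\<forall>y\<in>S. Q x \<le> Q y"
      using continuous_attains_inf[of S Q] False by blast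
    then show ?thesis using Q_pos by blast
  qed (auto intro: exI[of _ 1])
  then obtain q where q: "q > 0" "\<And>x. x \<in> S \<Longrightarrow> q \<le> Q x" by blast
  show ?thesis
  proof (intro exI[of _ q] conjI q allI impI)
    fix e assume e: "(\<Sum>i\<in>UNIV. \<omega> i * e i) = 0"
    define x :: "real^'n" where "x = (\<chi> i. e i)"
    have norm_x: "(norm x)\<^sup>2 = (\<Sum>i\<in>UNIV. (e i)\<^sup>2)"
      by (simp add: x_def norm_vec_def L2_set_def sum_nonneg)
    have Qx: "Q x = (\<Sum>i\<in>UNIV. \<Sum>j\<in>UNIV. p i * A $ i $ j * (e i - e j)\<^sup>2)"
      by (simp add: Q_def x_def)
    have scale: "Q (c *\<^sub>R x) = c\<^sup>2 * Q x" for c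
      unfolding Q_def sum_distrib_left
      by (intro sum.cong refl) (simp add: power2_eq_square algebra_simps)
    show "q * (\<Sum>i\<in>UNIV. (e i)\<^sup>2) \<le> (\<Sum>i\<in>UNIV. \<Sum>j\<in>UNIV. p i * A $ i $ j * (e i - e j)\<^sup>2)"
    proof (cases "x = 0")
      case True
      then show ?thesis using norm_x Qx Q_nn[of x] by simp
    next
      case False
      let ?x = "inverse (norm x) *\<^sub>R x"
      have "(\<Sum>i\<in>UNIV. \<omega> i * ?x $ i) = inverse (norm x) * (\<Sum>i\<in>UNIV. \<omega> i * e i)"
        unfolding sum_distrib_left by (intro sum.cong refl) (simp add: x_def)
      then have "?x \<in> S" using False e unfolding S_def by simp
      then have "q \<le> (inverse (norm x))\<^sup>2 * Q x" using q scale by metis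
      then have "q * (norm x)\<^sup>2 \<le> Q x" using False by (simp add: field_simps)
      then show ?thesis unfolding norm_x Qx .
    qed
  qed
qed

section \<open>The closed loop\<close>

text \<open>\<open>Acc i\<close> is the integral of the disagreement of agent \<open>i\<close>; with it as an additional state the closed
  loop is an autonomous system.\<close>

datatype 'n signal = Pos 'n | Vel 'n | Acc 'n | Gain 'n | Par 'n nat

text \<open>The initial values are parameters as well: the bounds derived below are uniform over
  time and over all solutions with this one initial state.\<close>

locale consensus_loop =
  fixes E :: "('n::finite \<times> 'n) set"
    and A :: "real^'n^'n"
    and l :: "'n \<Rightarrow> nat"
    and \<phi> :: "'n \<Rightarrow> real \<times> real \<Rightarrow> nat \<Rightarrow> real"
    and b :: "'n \<Rightarrow> real"
    and \<theta> :: "'n \<Rightarrow> nat \<Rightarrow> real"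
    and \<rho> lam \<nu> :: real
    and \<gamma> xbar :: "'n \<Rightarrow> real"
    and \<omega> :: "real^'n"
    and x0 v0 \<zeta>0 :: "'n \<Rightarrow> real"
    and \<theta>0 :: "'n \<Rightarrow> nat \<Rightarrow> real"
  assumes adj: "adjacency_matrix E A"
    and conn: "strongly_connected E"
    and b: "\<And>i. b i \<noteq> 0"
    and \<phi>: "\<And>i k. k < l i \<Longrightarrow> smooth (\<lambda>p. \<phi> i p k)"
    and \<rho>: "\<rho> > 0" and lam: "lam > 0" and \<nu>: "\<nu> > 0"
    and \<gamma>: "\<And>i. \<gamma> i > 0"
    and \<omega>: "\<omega> v* laplacian A = 0"
    and \<omega>_sum: "(\<Sum>k\<in>UNIV. \<omega> $ k) = 1"
begin

section \<open>The closed loop as an autonomous first-order system\<close>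

definition signals :: "'n signal set" where
  "signals = range Pos \<union> range Vel \<union> range Acc \<union> range Gain \<union> (\<Union>i. Par i ` {..<l i})"

lemma finite_signals [simp, intro]: "finite signals" by (simp add: signals_def)

lemma signals_memb [simp, intro]:
  "Pos i \<in> signals" "Vel i \<in> signals" "Acc i \<in> signals" "Gain i \<in> signals"
  "k < l i \<Longrightarrow> Par i k \<in> signals"
  by (auto simp: signals_def)

definition dis :: "'n \<Rightarrow> ('n \<Rightarrow> real) \<Rightarrow> real" where
  "dis i g = (\<Sum>j\<in>neighbors E i. A $ i $ j * (g i - g j))"

definition z_of :: "'n \<Rightarrow> ('n signal \<Rightarrow> real) \<Rightarrow> real" where
  "z_of i y = y (Pos i) - xbar i + \<rho> * y (Acc i)"

definition s_of :: "'n \<Rightarrow> ('n signal \<Rightarrow> real) \<Rightarrow> real" where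
  "s_of i y = y (Vel i) + \<rho> * dis i (\<lambda>j. y (Pos j)) + lam * z_of i y"

definition feedback_of :: "'n \<Rightarrow> ('n signal \<Rightarrow> real) \<Rightarrow> real" where
  "feedback_of i y = dot (l i) (\<lambda>k. y (Par i k)) (\<phi> i (y (Pos i), y (Vel i))) + lam * y (Vel i)
     + \<rho> * dis i (\<lambda>j. y (Vel j)) + lam * \<rho> * dis i (\<lambda>j. y (Pos j))"

definition control_of :: "'n \<Rightarrow> ('n signal \<Rightarrow> real) \<Rightarrow> real" where
  "control_of i y = nussbaum (y (Gain i)) * (feedback_of i y + \<nu> * s_of i y)"

fun field :: "'n signal \<Rightarrow> ('n signal \<Rightarrow> real) \<Rightarrow> real" where
  "field (Pos i) y = y (Vel i)"
| "field (Vel i) y = b i * control_of i y + dot (l i) (\<theta> i) (\<phi> i (y (Pos i), y (Vel i)))"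
| "field (Acc i) y = dis i (\<lambda>j. y (Pos j))"
| "field (Gain i) y = \<nu> * (s_of i y)\<^sup>2 + s_of i y * feedback_of i y"
| "field (Par i k) y = \<gamma> i * \<phi> i (y (Pos i), y (Vel i)) k * s_of i y"

primrec start :: "'n signal \<Rightarrow> real" where
  "start (Pos i) = x0 i"
| "start (Vel i) = v0 i"
| "start (Acc i) = 0"
| "start (Gain i) = \<zeta>0 i"
| "start (Par i k) = \<theta>0 i k"

text \<open>Only components in \<open>signals\<close> are constrained; \<open>Par i k\<close> with
  \<open>k \<ge> l i\<close> is arbitrary. The set \<open>S\<close> will be \<open>{0..T}\<close>
  for a priori bounds and \<open>{0..}\<close> for global solutions.\<close>

definition solution_on :: "real set \<Rightarrow> ('n signal \<Rightarrow> real \<Rightarrow> real) \<Rightarrow> bool" where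
  "solution_on S Y \<longleftrightarrow> (\<forall>k\<in>signals. Y k 0 = start k \<and>
     (\<forall>t\<in>S. (Y k has_real_derivative field k (\<lambda>j. Y j t)) (at t within S)))"

lemma solution_on_subset: "solution_on S Y \<Longrightarrow> S' \<subseteq> S \<Longrightarrow> solution_on S' Y"
  unfolding solution_on_def by (blast intro: DERIV_subset)

lemma solution_on_start: "solution_on S Y \<Longrightarrow> k \<in> signals \<Longrightarrow> Y k 0 = start k"
  unfolding solution_on_def by blast

lemma solution_on_deriv:
  "solution_on S Y \<Longrightarrow> k \<in> signals \<Longrightarrow> t \<in> S \<Longrightarrow>
    (Y k has_real_derivative field k (\<lambda>j. Y j t)) (at t within S)"
  unfolding solution_on_def by blast

section \<open>Local Lipschitz continuity of the vector field\<close>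

lemma locally_lipschitz_dis:
  assumes "\<And>j. locally_lipschitz I (g j)"
  shows "locally_lipschitz I (\<lambda>y. dis i (\<lambda>j. g j y))"
  unfolding dis_def
  by (intro locally_lipschitz_sum locally_lipschitz_mult locally_lipschitz_const
      locally_lipschitz_diff assms)

lemma locally_lipschitz_s_of: "locally_lipschitz signals (s_of i)"
  unfolding s_of_def z_of_def
  by (intro locally_lipschitz_dis locally_lipschitz_add locally_lipschitz_mult
      locally_lipschitz_diff locally_lipschitz_const locally_lipschitz_component) auto

lemma locally_lipschitz_\<phi>:
  "k < l i \<Longrightarrow> locally_lipschitz signals (\<lambda>y. \<phi> i (y (Pos i), y (Vel i)) k)"
  by (rule locally_lipschitz_smooth[where F = "\<lambda>p. \<phi> i p k"]) (auto intro: \<phi>)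

lemma locally_lipschitz_feedback_of: "locally_lipschitz signals (feedback_of i)"
  unfolding feedback_of_def dot_def
  by (intro locally_lipschitz_dis locally_lipschitz_add locally_lipschitz_mult locally_lipschitz_sum
      locally_lipschitz_diff locally_lipschitz_const locally_lipschitz_component locally_lipschitz_\<phi>) auto

lemma locally_lipschitz_control_of: "locally_lipschitz signals (control_of i)"
  unfolding control_of_def nussbaum_def
  by (intro locally_lipschitz_add locally_lipschitz_mult locally_lipschitz_power locally_lipschitz_cos
      locally_lipschitz_const locally_lipschitz_component locally_lipschitz_feedback_of
      locally_lipschitz_s_of) auto

lemma locally_lipschitz_field:
  assumes "k \<in> signals"
  shows "locally_lipschitz signals (field k)"
proof (cases k)
  case (Vel i)
  have "locally_lipschitz signals (\<lambda>y. dot (l i) (\<theta> i) (\<phi> i (y (Pos i), y (Vel i))))"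
    unfolding dot_def
    by (intro locally_lipschitz_mult locally_lipschitz_sum
        locally_lipschitz_const locally_lipschitz_\<phi>) auto
  then have "locally_lipschitz signals (\<lambda>y. field (Vel i) y)"
    unfolding field.simps
    by (intro locally_lipschitz_add locally_lipschitz_mult
        locally_lipschitz_const locally_lipschitz_control_of)
  then show ?thesis by (simp add: Vel del: field.simps)
next
  case (Par i n)
  then have "n < l i" using assms by (auto simp: signals_def)
  then have "locally_lipschitz signals (\<lambda>y. field (Par i n) y)"
    unfolding field.simps
    by (intro locally_lipschitz_mult locally_lipschitz_const locally_lipschitz_\<phi> locally_lipschitz_s_of)
  then show ?thesis by (simp add: Par del: field.simps)
next
  case (Gain i)
  have "locally_lipschitz signals (\<lambda>y. field (Gain i) y)"
    unfolding field.simps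
    by (intro locally_lipschitz_add locally_lipschitz_mult locally_lipschitz_power
        locally_lipschitz_const locally_lipschitz_s_of locally_lipschitz_feedback_of)
  then show ?thesis by (simp add: Gain del: field.simps)
next
  case (Acc i)
  have "locally_lipschitz signals (\<lambda>y. field (Acc i) y)"
    unfolding field.simps
    by (intro locally_lipschitz_dis locally_lipschitz_component) auto
  then show ?thesis by (simp add: Acc del: field.simps)
next
  case (Pos i)
  have "locally_lipschitz signals (\<lambda>y. field (Pos i) y)"
    unfolding field.simps by (intro locally_lipschitz_component) auto
  then show ?thesis by (simp add: Pos del: field.simps)
qed

section \<open>The disagreement operator and the consensus error\<close>

lemma dis_UNIV: "dis i g = (\<Sum>j\<in>UNIV. A $ i $ j * (g i - g j))"
  unfolding dis_def
  by (rule sum.mono_neutral_left)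
    (use adj in \<open>auto simp: neighbors_def adjacency_matrix_def\<close>)

lemma dis_add: "dis i (\<lambda>j. g j + h j) = dis i g + dis i h"
  unfolding dis_def by (simp add: algebra_simps flip: sum.distrib)

lemma dis_shift: "dis i (\<lambda>j. g j + c) = dis i g"
  unfolding dis_def by simp

text \<open>\<open>dis i g\<close> is entry \<open>i\<close> of the Laplacian applied to
  \<open>g\<close>, and \<open>\<omega>\<close> annihilates the Laplacian from the left.\<close>

lemma \<omega>_dis: "(\<Sum>i\<in>UNIV. \<omega> $ i * dis i g) = 0"
proof -
  have "(\<Sum>i\<in>UNIV. \<omega> $ i * dis i g) =
      (\<Sum>i\<in>UNIV. \<omega> $ i * in_degree A i * g i) - (\<Sum>i\<in>UNIV. \<Sum>j\<in>UNIV. \<omega> $ i * A $ i $ j * g j)"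
    by (simp add: dis_UNIV in_degree_def sum_distrib_left sum_distrib_right right_diff_distrib
        sum_subtractf mult.assoc)
  also have "(\<Sum>i\<in>UNIV. \<Sum>j\<in>UNIV. \<omega> $ i * A $ i $ j * g j) = (\<Sum>i\<in>UNIV. \<omega> $ i * in_degree A i * g i)"
    using \<omega> unfolding left_null_vector_laplacian by (subst sum.swap) (simp add: sum_distrib_right)
  finally show ?thesis by simp
qed

definition target :: real where "target = (\<Sum>k\<in>UNIV. \<omega> $ k * xbar k)"

text \<open>Equals the position minus \<open>z_of\<close> minus \<open>target\<close>. Written
  through \<open>Acc\<close>, its derivative is a multiple of the disagreement, free of
  velocities.\<close>

definition e_of :: "'n \<Rightarrow> ('n signal \<Rightarrow> real) \<Rightarrow> real" where
  "e_of i y = xbar i - \<rho> * y (Acc i) - target"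

lemma Pos_eq: "y (Pos i) = z_of i y + e_of i y + target"
  by (simp add: z_of_def e_of_def)

lemma dis_Pos: "dis i (\<lambda>j. y (Pos j)) = dis i (\<lambda>j. z_of j y) + dis i (\<lambda>j. e_of j y)"
  unfolding Pos_eq dis_shift dis_add ..

lemma dis_deriv:
  assumes "\<And>j. (g j has_real_derivative g' j) (at t within S)"
  shows "((\<lambda>t. dis i (\<lambda>j. g j t)) has_real_derivative dis i g') (at t within S)"
  unfolding dis_def by (intro DERIV_sum DERIV_cmult DERIV_diff assms)

section \<open>Derivatives along solutions and the energy identity\<close>

definition s_rate :: "'n \<Rightarrow> ('n signal \<Rightarrow> real) \<Rightarrow> real" where
  "s_rate i y = field (Vel i) y + \<rho> * dis i (\<lambda>j. y (Vel j)) + lam * (y (Vel i) + \<rho> * dis i (\<lambda>j. y (Pos j)))"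

definition energy :: "'n \<Rightarrow> ('n signal \<Rightarrow> real) \<Rightarrow> real" where
  "energy i y = (s_of i y)\<^sup>2 / 2 + (\<Sum>k<l i. (y (Par i k) - \<theta> i k)\<^sup>2) / (2 * \<gamma> i)"

text \<open>A primitive of \<open>b i * nussbaum k + 1\<close>, evaluated at the gain; the summand
  \<open>y (Gain i)\<close> comes from the 1.\<close>

definition potential :: "'n \<Rightarrow> ('n signal \<Rightarrow> real) \<Rightarrow> real" where
  "potential i y = b i * nussbaum_integral (y (Gain i)) + y (Gain i)"

context
  fixes S Y t
  assumes sol: "solution_on S Y" and t: "t \<in> S"
begin

lemmas rate = solution_on_deriv[OF sol _ t]

lemma z_of_deriv:
  "((\<lambda>t. z_of i (\<lambda>k. Y k t)) has_real_derivative
    s_of i (\<lambda>k. Y k t) - lam * z_of i (\<lambda>k. Y k t)) (at t within S)"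
  unfolding s_of_def z_of_def
  by (auto intro!: derivative_eq_intros rate[of "Pos i", simplified] rate[of "Acc i", simplified])

lemma s_of_deriv:
  "((\<lambda>t. s_of i (\<lambda>k. Y k t)) has_real_derivative s_rate i (\<lambda>k. Y k t)) (at t within S)"
  unfolding s_of_def
  by (rule derivative_eq_intros dis_deriv rate z_of_deriv refl signals_memb)+
    (simp add: s_rate_def s_of_def)

lemma e_of_deriv:
  "((\<lambda>t. e_of i (\<lambda>k. Y k t)) has_real_derivative - \<rho> * dis i (\<lambda>j. Y (Pos j) t)) (at t within S)"
  unfolding e_of_def
  by (rule derivative_eq_intros rate refl signals_memb)+ simp

text \<open>The adaptation law contributes \<open>s * (P - Q)\<close>, which replaces the unknown
  \<open>Q\<close> in \<open>s * s_rate\<close> by its estimate \<open>P\<close>. What remains is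
  \<open>s\<close> times the feedback, that is the rate of the gain minus
  \<open>\<nu> * s\<^sup>2\<close>, plus the control term, which is \<open>b i * N\<close> times the
  rate of the gain.\<close>

lemma energy_deriv:
  "((\<lambda>t. energy i (\<lambda>k. Y k t) - potential i (\<lambda>k. Y k t)) has_real_derivative
    - \<nu> * (s_of i (\<lambda>k. Y k t))\<^sup>2) (at t within S)"
proof -
  let ?y = "\<lambda>k. Y k t"
  let ?s = "s_of i ?y" and ?\<phi> = "\<phi> i (Y (Pos i) t, Y (Vel i) t)" and ?N = "nussbaum (Y (Gain i) t)"
  \<comment> \<open>\<open>P\<close> and \<open>Q\<close> are the nonlinearity with estimated and
    with true parameters.\<close>
  define P where "P = (\<Sum>k<l i. Y (Par i k) t * ?\<phi> k)"
  define Q where "Q = (\<Sum>k<l i. \<theta> i k * ?\<phi> k)"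
  have 1: "((\<lambda>t. (s_of i (\<lambda>k. Y k t))\<^sup>2 / 2) has_real_derivative ?s * s_rate i ?y) (at t within S)"
    by (auto intro!: derivative_eq_intros s_of_deriv)
  have "((\<lambda>t. \<Sum>k<l i. (Y (Par i k) t - \<theta> i k)\<^sup>2) has_real_derivative
      (\<Sum>k<l i. 2 * (Y (Par i k) t - \<theta> i k) * (\<gamma> i * ?\<phi> k * ?s))) (at t within S)"
    by (auto intro!: derivative_eq_intros sum.cong rate[of "Par i _", simplified])
  from DERIV_cdivide[OF this, of "2 * \<gamma> i"]
  have "((\<lambda>t. (\<Sum>k<l i. (Y (Par i k) t - \<theta> i k)\<^sup>2) / (2 * \<gamma> i)) has_real_derivative
      (\<Sum>k<l i. 2 * (Y (Par i k) t - \<theta> i k) * (\<gamma> i * ?\<phi> k * ?s)) / (2 * \<gamma> i)) (at t within S)" .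
  also have "(\<Sum>k<l i. 2 * (Y (Par i k) t - \<theta> i k) * (\<gamma> i * ?\<phi> k * ?s)) / (2 * \<gamma> i) = ?s * (P - Q)"
    unfolding P_def Q_def sum_divide_distrib sum_subtractf[symmetric] sum_distrib_left
    using \<gamma>[of i] by (intro sum.cong refl) (simp add: field_simps)
  finally have 2: "((\<lambda>t. (\<Sum>k<l i. (Y (Par i k) t - \<theta> i k)\<^sup>2) / (2 * \<gamma> i)) has_real_derivative
      ?s * (P - Q)) (at t within S)" .
  have 3: "((\<lambda>t. potential i (\<lambda>k. Y k t)) has_real_derivative
      (b i * ?N + 1) * field (Gain i) ?y) (at t within S)"
    unfolding potential_def by (rule derivative_eq_intros rate refl signals_memb)+ (simp add: algebra_simps)
  have "?s * s_rate i ?y + ?s * (P - Q) - (b i * ?N + 1) * field (Gain i) ?y = - \<nu> * ?s\<^sup>2"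
    by (simp add: s_rate_def control_of_def feedback_of_def dot_def P_def[symmetric] Q_def[symmetric])
      (simp add: algebra_simps power2_eq_square)
  then show ?thesis
    unfolding energy_def using DERIV_diff[OF DERIV_add[OF 1 2] 3] by simp
qed

end

lemma energy_le:
  assumes sol: "solution_on {0..T} Y" and T: "0 \<le> T"
  shows "energy i (\<lambda>k. Y k T) \<le> potential i (\<lambda>k. Y k T) + (energy i start - potential i start)"
proof -
  have "energy i (\<lambda>k. Y k T) - potential i (\<lambda>k. Y k T) \<le> energy i (\<lambda>k. Y k 0) - potential i (\<lambda>k. Y k 0)"
    by (rule nonincreasing_on_interval[OF T energy_deriv[OF sol]]) (use \<nu> in auto)
  \<comment> \<open>At time 0 the path agrees with \<open>start\<close> on \<open>signals\<close>
    only, so equality is checked for each functional instead of for the whole state.\<close>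
  moreover have "s_of i (\<lambda>k. Y k 0) = s_of i start"
    using solution_on_start[OF sol] by (simp add: s_of_def z_of_def dis_def)
  then have "energy i (\<lambda>k. Y k 0) = energy i start" "potential i (\<lambda>k. Y k 0) = potential i start"
    using solution_on_start[OF sol] by (simp_all add: energy_def potential_def)
  ultimately show ?thesis by simp
qed

lemma energy_nonneg: "0 \<le> energy i y"
  unfolding energy_def using \<gamma>[of i] by (intro add_nonneg_nonneg divide_nonneg_nonneg sum_nonneg) auto

text \<open>By \<open>\<omega>_dis\<close> the weighted sum is conserved. Initially
  \<open>Acc\<close> is 0, and the sum vanishes by the choice of \<open>target\<close> and the
  normalization of \<open>\<omega>\<close>: this fixes the consensus value.\<close>

lemma \<omega>_e_of:
  assumes sol: "solution_on {0..T} Y" and T: "0 \<le> T"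
  shows "(\<Sum>i\<in>UNIV. \<omega> $ i * e_of i (\<lambda>k. Y k T)) = 0"
proof -
  let ?f = "\<lambda>t. \<Sum>i\<in>UNIV. \<omega> $ i * e_of i (\<lambda>k. Y k t)"
  have "(?f has_real_derivative 0) (at t within {0..T})" if t: "t \<in> {0..T}" for t
  proof -
    have "(?f has_real_derivative (\<Sum>i\<in>UNIV. \<omega> $ i * (- \<rho> * dis i (\<lambda>j. Y (Pos j) t)))) (at t within {0..T})"
      by (intro DERIV_sum DERIV_cmult e_of_deriv[OF sol t])
    also have "(\<Sum>i\<in>UNIV. \<omega> $ i * (- \<rho> * dis i (\<lambda>j. Y (Pos j) t))) =
        - \<rho> * (\<Sum>i\<in>UNIV. \<omega> $ i * dis i (\<lambda>j. Y (Pos j) t))"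
      unfolding sum_distrib_left by (intro sum.cong refl) simp
    finally show ?thesis by (simp add: \<omega>_dis)
  qed
  then have "\<exists>c. \<forall>t\<in>{0..T}. ?f t = c"
    by (intro has_field_derivative_zero_constant) auto
  then have "?f T = ?f 0" using T by auto
  also have "?f 0 = (\<Sum>i\<in>UNIV. \<omega> $ i * xbar i) - (\<Sum>i\<in>UNIV. \<omega> $ i) * target"
    using solution_on_start[OF sol] by (simp add: e_of_def right_diff_distrib sum_subtractf sum_distrib_right)
  also have "\<dots> = 0" using \<omega>_sum by (simp add: target_def)
  finally show ?thesis .
qed

section \<open>Reachable states and a calculus of uniform bounds\<close>

definition reachable :: "('n signal \<Rightarrow> real) set" where
  "reachable = {\<lambda>k. Y k T | Y T. 0 \<le> T \<and> solution_on {0..T} Y}"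

lemma reachableE:
  assumes "y \<in> reachable"
  obtains Y T where "0 \<le> T" "solution_on {0..T} Y" "y = (\<lambda>k. Y k T)"
  using assms unfolding reachable_def by blast

lemma reachableI: "solution_on S Y \<Longrightarrow> 0 \<le> t \<Longrightarrow> {0..t} \<subseteq> S \<Longrightarrow> (\<lambda>k. Y k t) \<in> reachable"
  unfolding reachable_def using solution_on_subset by blast

text \<open>One bound for all solutions from the initial state and all interval lengths, which is
  the kind of a priori bound that \<open>ode_global_solution\<close> requires.\<close>

definition bounded_reach :: "(('n signal \<Rightarrow> real) \<Rightarrow> real) \<Rightarrow> bool" where
  "bounded_reach f \<longleftrightarrow> (\<exists>B. \<forall>y\<in>reachable. \<bar>f y\<bar> \<le> B)"

lemma bounded_reachI: "(\<And>y. y \<in> reachable \<Longrightarrow> \<bar>f y\<bar> \<le> B) \<Longrightarrow> bounded_reach f"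
  unfolding bounded_reach_def by blast

lemma bounded_reachE:
  assumes "bounded_reach f"
  obtains B where "\<forall>y\<in>reachable. \<bar>f y\<bar> \<le> B"
  using assms unfolding bounded_reach_def by blast

lemma bounded_reach_mono:
  assumes "bounded_reach g" "\<And>y. y \<in> reachable \<Longrightarrow> \<bar>f y\<bar> \<le> \<bar>g y\<bar>"
  shows "bounded_reach f"
  using assms unfolding bounded_reach_def by (meson order_trans)

lemma bounded_reach_const: "bounded_reach (\<lambda>y. c)"
  by (rule bounded_reachI) (rule order_refl)

lemma bounded_reach_add:
  assumes "bounded_reach f" "bounded_reach g"
  shows "bounded_reach (\<lambda>y. f y + g y)"
proof -
  obtain B C where "\<And>y. y \<in> reachable \<Longrightarrow> \<bar>f y\<bar> \<le> B" "\<And>y. y \<in> reachable \<Longrightarrow> \<bar>g y\<bar> \<le> C"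
    using assms unfolding bounded_reach_def by blast
  then show ?thesis
    by (intro bounded_reachI[of _ "B + C"]) (meson abs_triangle_ineq add_mono order_trans)
qed

lemma bounded_reach_mult:
  assumes "bounded_reach f" "bounded_reach g"
  shows "bounded_reach (\<lambda>y. f y * g y)"
proof -
  obtain B C where BC: "\<And>y. y \<in> reachable \<Longrightarrow> \<bar>f y\<bar> \<le> B" "\<And>y. y \<in> reachable \<Longrightarrow> \<bar>g y\<bar> \<le> C"
    using assms unfolding bounded_reach_def by blast
  have "\<bar>f y * g y\<bar> \<le> B * C" if "y \<in> reachable" for y
    unfolding abs_mult using BC[OF that] by (intro mult_mono) auto
  then show ?thesis by (rule bounded_reachI)
qed

lemma bounded_reach_diff:
  assumes "bounded_reach f" "bounded_reach g"
  shows "bounded_reach (\<lambda>y. f y - g y)"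
  using bounded_reach_add[OF assms(1) bounded_reach_mult[OF bounded_reach_const[of "-1"] assms(2)]]
  by simp

lemma bounded_reach_power: "bounded_reach f \<Longrightarrow> bounded_reach (\<lambda>y. f y ^ n)"
  by (induction n) (simp_all add: bounded_reach_const bounded_reach_mult)

lemma bounded_reach_sum:
  "(\<And>a. a \<in> I \<Longrightarrow> bounded_reach (f a)) \<Longrightarrow> bounded_reach (\<lambda>y. \<Sum>a\<in>I. f a y)"
  by (induction I rule: infinite_finite_induct) (simp_all add: bounded_reach_const bounded_reach_add)

lemma bounded_reach_dis:
  "(\<And>j. bounded_reach (g j)) \<Longrightarrow> bounded_reach (\<lambda>y. dis i (\<lambda>j. g j y))"
  unfolding dis_def
  by (intro bounded_reach_sum bounded_reach_mult bounded_reach_diff bounded_reach_const)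

lemma bounded_reach_sin: "bounded_reach (\<lambda>y. sin (f y))"
  by (rule bounded_reachI[of _ 1]) simp

lemma bounded_reach_cos: "bounded_reach (\<lambda>y. cos (f y))"
  by (rule bounded_reachI[of _ 1]) simp

lemmas bounded_reach_intros = bounded_reach_const bounded_reach_add bounded_reach_mult
  bounded_reach_diff bounded_reach_power bounded_reach_sum bounded_reach_dis
  bounded_reach_sin bounded_reach_cos

text \<open>The inequality \<open>2 * \<bar>f y\<bar> \<le> (f y)\<^sup>2 + 1\<close> turns a bound
  on the square into one on \<open>f\<close> without square roots.\<close>

lemma bounded_reach_square:
  assumes g: "bounded_reach g" and le: "\<And>y. y \<in> reachable \<Longrightarrow> (f y)\<^sup>2 \<le> g y"
  shows "bounded_reach f"
proof (rule bounded_reach_mono[OF bounded_reach_add[OF g bounded_reach_const[of 1]]])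
  fix y assume y: "y \<in> reachable"
  have "0 \<le> (\<bar>f y\<bar> - 1)\<^sup>2" by simp
  then have "2 * \<bar>f y\<bar> \<le> (f y)\<^sup>2 + 1" by (simp add: power2_diff)
  then show "\<bar>f y\<bar> \<le> \<bar>g y + 1\<bar>" using le[OF y] by linarith
qed

section \<open>Uniform bounds on gains, estimates and filtered errors\<close>

lemma bounded_reach_Gain: "bounded_reach (\<lambda>y. y (Gain i))"
proof -
  \<comment> \<open>Since the energy is nonnegative, \<open>energy_le\<close> bounds the potential
    from below by this constant of the initial data.\<close>
  obtain K where K: "\<forall>(T :: real) \<zeta>. continuous_on {0..T} \<zeta> \<longrightarrow> \<zeta> 0 = \<zeta>0 i \<longrightarrow>
     (\<forall>t\<in>{0..T}. potential i start - energy i start \<le> b i * nussbaum_integral (\<zeta> t) + \<zeta> t) \<longrightarrow>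
     (\<forall>t\<in>{0..T}. \<bar>\<zeta> t\<bar> \<le> K)"
    using nussbaum_confines[OF b] by blast
  show ?thesis
  proof (rule bounded_reachI)
    fix y assume "y \<in> reachable"
    then obtain Y T where T: "0 \<le> T" and sol: "solution_on {0..T} Y" and y: "y = (\<lambda>k. Y k T)"
      by (rule reachableE)
    have "\<bar>Y (Gain i) t\<bar> \<le> K" if "t \<in> {0..T}" for t
    proof (rule K[rule_format, of T "Y (Gain i)" t])
      show "continuous_on {0..T} (Y (Gain i))"
        by (rule DERIV_continuous_on[OF solution_on_deriv[OF sol]]) auto
      show "Y (Gain i) 0 = \<zeta>0 i" using solution_on_start[OF sol, of "Gain i"] by simp
      fix t assume t: "t \<in> {0..T}"
      \<comment> \<open>Initial segments of solutions are solutions, so the energy inequality holds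
        at every intermediate time.\<close>
      have "solution_on {0..t} Y" by (rule solution_on_subset[OF sol]) (use t in auto)
      from energy_le[OF this, of i] energy_nonneg[of i "\<lambda>k. Y k t"] t
      show "potential i start - energy i start \<le> b i * nussbaum_integral (Y (Gain i) t) + Y (Gain i) t"
        unfolding potential_def by auto
    qed (rule that)
    then show "\<bar>y (Gain i)\<bar> \<le> K" using T y by auto
  qed
qed

lemma bounded_reach_potential: "bounded_reach (potential i)"
  unfolding potential_def nussbaum_integral_def
  by (intro bounded_reach_intros bounded_reach_Gain)

lemma bounded_reach_energy: "bounded_reach (energy i)"
proof (rule bounded_reach_mono)
  show "bounded_reach (\<lambda>y. potential i y + (energy i start - potential i start))"
    by (intro bounded_reach_intros bounded_reach_potential)
  fix y assume "y \<in> reachable"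
  then obtain Y T where "0 \<le> T" "solution_on {0..T} Y" "y = (\<lambda>k. Y k T)" by (rule reachableE)
  then show "\<bar>energy i y\<bar> \<le> \<bar>potential i y + (energy i start - potential i start)\<bar>"
    using energy_le[of T Y i] energy_nonneg[of i y] by simp
qed

lemma bounded_reach_s_of: "bounded_reach (s_of i)"
proof (rule bounded_reach_square)
  show "bounded_reach (\<lambda>y. 2 * energy i y)" by (intro bounded_reach_intros bounded_reach_energy)
  fix y
  have "0 \<le> (\<Sum>k<l i. (y (Par i k) - \<theta> i k)\<^sup>2) / (2 * \<gamma> i)"
    using \<gamma>[of i] by (intro divide_nonneg_nonneg sum_nonneg) auto
  then show "(s_of i y)\<^sup>2 \<le> 2 * energy i y" by (simp add: energy_def)
qed

lemma bounded_reach_Par: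
  assumes k: "k < l i"
  shows "bounded_reach (\<lambda>y. y (Par i k))"
proof -
  have "bounded_reach (\<lambda>y. y (Par i k) - \<theta> i k)"
  proof (rule bounded_reach_square)
    show "bounded_reach (\<lambda>y. 2 * \<gamma> i * energy i y)"
      by (intro bounded_reach_intros bounded_reach_energy)
    fix y
    have "(y (Par i k) - \<theta> i k)\<^sup>2 \<le> (\<Sum>k<l i. (y (Par i k) - \<theta> i k)\<^sup>2)"
      using member_le_sum[of k "{..<l i}" "\<lambda>k. (y (Par i k) - \<theta> i k)\<^sup>2"] k by simp
    also have "\<dots> \<le> 2 * \<gamma> i * energy i y"
      using \<gamma>[of i] by (simp add: energy_def distrib_left)
    finally show "(y (Par i k) - \<theta> i k)\<^sup>2 \<le> 2 * \<gamma> i * energy i y" .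
  qed
  from bounded_reach_add[OF this bounded_reach_const[of "\<theta> i k"]] show ?thesis by simp
qed

text \<open>Young's inequality: half of the damping of the square of \<open>z_of\<close> absorbs the
  cross term with \<open>s_of\<close>. The left-hand side is the derivative of that square along a
  solution.\<close>

lemma z_of_square_rate:
  "2 * z_of i y * (s_of i y - lam * z_of i y) \<le> - lam * (z_of i y)\<^sup>2 + (s_of i y)\<^sup>2 / lam"
proof -
  have "0 \<le> (lam * z_of i y - s_of i y)\<^sup>2 / lam" using lam by simp
  then show ?thesis using lam by (simp add: power2_eq_square field_simps)
qed

lemma z_of_square_deriv:
  assumes "solution_on S Y" "t \<in> S"
  shows "((\<lambda>t. (z_of i (\<lambda>k. Y k t))\<^sup>2) has_real_derivative
    2 * z_of i (\<lambda>k. Y k t) * (s_of i (\<lambda>k. Y k t) - lam * z_of i (\<lambda>k. Y k t))) (at t within S)"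
  by (auto intro!: derivative_eq_intros z_of_deriv[OF assms])

lemma bounded_reach_z_of: "bounded_reach (z_of i)"
proof -
  obtain M where M: "\<forall>y\<in>reachable. \<bar>(s_of i y)\<^sup>2\<bar> \<le> M"
    using bounded_reach_power[OF bounded_reach_s_of] by (rule bounded_reachE)
  show ?thesis
  proof (rule bounded_reach_square[OF bounded_reach_const])
    fix y assume "y \<in> reachable"
    then obtain Y T where T: "0 \<le> T" and sol: "solution_on {0..T} Y" and y: "y = (\<lambda>k. Y k T)"
      by (rule reachableE)
    \<comment> \<open>\<open>M\<close> is divided by \<open>lam\<close> once in the forcing term and
      once more by the decay rate.\<close>
    have "(z_of i (\<lambda>k. Y k T))\<^sup>2 \<le> max ((z_of i (\<lambda>k. Y k 0))\<^sup>2) (M / lam / lam)"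
    proof (rule exponential_decay_le_max[OF T lam z_of_square_deriv[OF sol]])
      fix t assume t: "t \<in> {0..T}"
      have "(\<lambda>k. Y k t) \<in> reachable" by (rule reachableI[OF sol]) (use t in auto)
      then have "(s_of i (\<lambda>k. Y k t))\<^sup>2 / lam \<le> M / lam"
        using M lam by (intro divide_right_mono) (auto simp: abs_le_iff)
      then show "2 * z_of i (\<lambda>k. Y k t) * (s_of i (\<lambda>k. Y k t) - lam * z_of i (\<lambda>k. Y k t))
          \<le> - lam * (z_of i (\<lambda>k. Y k t))\<^sup>2 + M / lam"
        using z_of_square_rate[of i "\<lambda>k. Y k t"] by linarith
    qed
    also have "z_of i (\<lambda>k. Y k 0) = z_of i start"
      using solution_on_start[OF sol] by (simp add: z_of_def)
    finally show "(z_of i y)\<^sup>2 \<le> max ((z_of i start)\<^sup>2) (M / lam / lam)" unfolding y .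
  qed
qed

section \<open>Exponential dissipation of the consensus error\<close>

definition lyapunov :: "('n signal \<Rightarrow> real) \<Rightarrow> real" where
  "lyapunov y = (\<Sum>i\<in>UNIV. \<bar>\<omega> $ i\<bar> * (e_of i y)\<^sup>2)"

definition lyapunov_rate :: "('n signal \<Rightarrow> real) \<Rightarrow> real" where
  "lyapunov_rate y = (\<Sum>i\<in>UNIV. \<bar>\<omega> $ i\<bar> * (2 * e_of i y * (- \<rho> * dis i (\<lambda>j. y (Pos j)))))"

lemma lyapunov_deriv:
  assumes "solution_on S Y" "t \<in> S"
  shows "((\<lambda>t. lyapunov (\<lambda>k. Y k t)) has_real_derivative lyapunov_rate (\<lambda>k. Y k t)) (at t within S)"
  unfolding lyapunov_def lyapunov_rate_def
  by (auto intro!: derivative_eq_intros sum.cong e_of_deriv[OF assms])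

lemma abs_\<omega>_pos: "0 < \<bar>\<omega> $ i\<bar>"
proof -
  have "\<omega> \<noteq> 0" using \<omega>_sum by auto
  then show ?thesis using left_null_vector_nonzero[OF adj conn \<omega>] by simp
qed

text \<open>The disagreement of the positions splits into that of \<open>e\<close> and that of
  \<open>z\<close>. Since the weights \<open>\<bar>\<omega> $ i\<bar>\<close> are again balanced,
  the first part is a disagreement form, coercive on the hyperplane; the second is a disturbance
  handled by Young's inequality. Both constants are chosen before the state.\<close>

lemma lyapunov_rate_le:
  "\<exists>\<kappa>>0. \<exists>C\<ge>0. \<forall>y. (\<Sum>i\<in>UNIV. \<omega> $ i * e_of i y) = 0 \<longrightarrow>
    lyapunov_rate y \<le> - \<kappa> * lyapunov y + C * (\<Sum>i\<in>UNIV. (dis i (\<lambda>j. z_of j y))\<^sup>2)"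
proof -
  define p where "p i = \<bar>\<omega> $ i\<bar>" for i
  have p: "0 < p i" for i unfolding p_def by (rule abs_\<omega>_pos)
  obtain q where q: "q > 0" "\<And>e. (\<Sum>i\<in>UNIV. \<omega> $ i * e i) = 0 \<Longrightarrow>
    q * (\<Sum>i\<in>UNIV. (e i)\<^sup>2) \<le> (\<Sum>i\<in>UNIV. \<Sum>j\<in>UNIV. p i * A $ i $ j * (e i - e j)\<^sup>2)"
    using disagreement_form_coercive[of E A p "\<lambda>i. \<omega> $ i"] adj conn p \<omega>_sum by auto
  \<comment> \<open>The total weight serves as a common upper bound for the individual
    weights.\<close>
  define P where "P = (\<Sum>i\<in>UNIV. p i)"
  have P: "p i \<le> P" for i unfolding P_def using p by (intro member_le_sum) (auto intro: less_imp_le)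
  have P0: "P > 0" using P p by (meson less_le_trans)
  have pos: "0 < \<rho> * q / (2 * P)" "0 \<le> 2 * \<rho> * P\<^sup>2 / q" using \<rho> q P0 by auto
  have "lyapunov_rate y \<le> - (\<rho> * q / (2 * P)) * lyapunov y
      + 2 * \<rho> * P\<^sup>2 / q * (\<Sum>i\<in>UNIV. (dis i (\<lambda>j. z_of j y))\<^sup>2)"
    if y: "(\<Sum>i\<in>UNIV. \<omega> $ i * e_of i y) = 0" for y
  proof -
    define e where "e i = e_of i y" for i
    define z where "z i = z_of i y" for i
    have split: "dis i (\<lambda>j. y (Pos j)) = dis i z + dis i e" for i
      using dis_Pos[of i y] unfolding e_def z_def by simp
    have "(\<Sum>i\<in>UNIV. p i * e i * dis i e) = (\<Sum>i\<in>UNIV. \<Sum>j\<in>UNIV. p i * A $ i $ j * (e i - e j)\<^sup>2) / 2"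
      unfolding dis_UNIV
      by (rule laplacian_quadratic_form) (use abs_left_null_vector[OF adj \<omega>] in \<open>simp add: p_def\<close>)
    also have "\<dots> \<ge> q / 2 * (\<Sum>i\<in>UNIV. (e i)\<^sup>2)" using q(2)[of e] y unfolding e_def by simp
    finally have diss: "q / 2 * (\<Sum>i\<in>UNIV. (e i)\<^sup>2) \<le> (\<Sum>i\<in>UNIV. p i * e i * dis i e)" .
    \<comment> \<open>Completing the square. The coefficient \<open>q / 2\<close> of the error is
      chosen so that exactly half of the dissipation from \<open>diss\<close> is spent.\<close>
    have young: "- 2 * (p i * e i * dis i z) \<le> q / 2 * (e i)\<^sup>2 + 2 * P\<^sup>2 / q * (dis i z)\<^sup>2" for i
    proof -
      have "0 \<le> q / 2 * (e i + 2 / q * (p i * dis i z))\<^sup>2" using q by simp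
      also have "\<dots> = q / 2 * (e i)\<^sup>2 + 2 * (p i * e i * dis i z) + 2 * (p i)\<^sup>2 / q * (dis i z)\<^sup>2"
        using q by (simp add: power2_eq_square field_simps)
      finally have "- 2 * (p i * e i * dis i z) \<le> q / 2 * (e i)\<^sup>2 + 2 * (p i)\<^sup>2 / q * (dis i z)\<^sup>2" by simp
      also have "2 * (p i)\<^sup>2 / q * (dis i z)\<^sup>2 \<le> 2 * P\<^sup>2 / q * (dis i z)\<^sup>2"
        using P[of i] p[of i] q by (intro mult_right_mono divide_right_mono mult_left_mono power_mono) auto
      finally show ?thesis by simp
    qed
    have "lyapunov_rate y = \<rho> * (\<Sum>i\<in>UNIV. - 2 * (p i * e i * dis i z)) - 2 * \<rho> * (\<Sum>i\<in>UNIV. p i * e i * dis i e)"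
      unfolding lyapunov_rate_def split p_def[symmetric] e_def[symmetric] sum_distrib_left sum_subtractf[symmetric]
      by (intro sum.cong refl) (simp add: algebra_simps)
    also have "\<dots> \<le> \<rho> * (\<Sum>i\<in>UNIV. q / 2 * (e i)\<^sup>2 + 2 * P\<^sup>2 / q * (dis i z)\<^sup>2) - 2 * \<rho> * (q / 2 * (\<Sum>i\<in>UNIV. (e i)\<^sup>2))"
      using \<rho> by (intro diff_mono mult_left_mono sum_mono young diss) auto
    also have "\<dots> = - (\<rho> * q / 2) * (\<Sum>i\<in>UNIV. (e i)\<^sup>2) + 2 * \<rho> * P\<^sup>2 / q * (\<Sum>i\<in>UNIV. (dis i z)\<^sup>2)"
      unfolding sum.distrib sum_distrib_left[symmetric] by (simp add: algebra_simps)
    \<comment> \<open>Passing from the plain to the weighted sum of squares costs the factor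
      \<open>P\<close>.\<close>
    also have "- (\<rho> * q / 2) * (\<Sum>i\<in>UNIV. (e i)\<^sup>2) \<le> - (\<rho> * q / (2 * P)) * (\<Sum>i\<in>UNIV. p i * (e i)\<^sup>2)"
    proof -
      have "(\<Sum>i\<in>UNIV. p i * (e i)\<^sup>2) \<le> P * (\<Sum>i\<in>UNIV. (e i)\<^sup>2)"
        unfolding sum_distrib_left by (intro sum_mono mult_right_mono P) auto
      then have "\<rho> * q / (2 * P) * (\<Sum>i\<in>UNIV. p i * (e i)\<^sup>2) \<le> \<rho> * q / (2 * P) * (P * (\<Sum>i\<in>UNIV. (e i)\<^sup>2))"
        using \<rho> q P0 by (intro mult_left_mono) auto
      then show ?thesis using P0 by simp
    qed
    finally show ?thesis unfolding lyapunov_def p_def e_def z_def by simp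
  qed
  then show ?thesis using pos by blast
qed

lemma e_of_square_le: "(e_of i y)\<^sup>2 \<le> lyapunov y / \<bar>\<omega> $ i\<bar>"
proof -
  have "\<bar>\<omega> $ i\<bar> * (e_of i y)\<^sup>2 \<le> lyapunov y"
    unfolding lyapunov_def
    by (rule member_le_sum[of i UNIV "\<lambda>i. \<bar>\<omega> $ i\<bar> * (e_of i y)\<^sup>2"]) auto
  then show ?thesis using abs_\<omega>_pos[of i] by (simp add: pos_le_divide_eq mult.commute)
qed

lemma bounded_reach_lyapunov: "bounded_reach lyapunov"
proof -
  obtain \<kappa> C where \<kappa>: "\<kappa> > 0" and C: "C \<ge> 0"
    and rate: "\<And>y. (\<Sum>i\<in>UNIV. \<omega> $ i * e_of i y) = 0 \<Longrightarrow>
      lyapunov_rate y \<le> - \<kappa> * lyapunov y + C * (\<Sum>i\<in>UNIV. (dis i (\<lambda>j. z_of j y))\<^sup>2)"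
    using lyapunov_rate_le by blast
  have "bounded_reach (\<lambda>y. C * (\<Sum>i\<in>UNIV. (dis i (\<lambda>j. z_of j y))\<^sup>2))"
    by (intro bounded_reach_intros bounded_reach_z_of)
  then obtain M where M: "\<forall>y\<in>reachable. \<bar>C * (\<Sum>i\<in>UNIV. (dis i (\<lambda>j. z_of j y))\<^sup>2)\<bar> \<le> M"
    by (rule bounded_reachE)
  show ?thesis
  proof (rule bounded_reachI)
    fix y assume "y \<in> reachable"
    then obtain Y T where T: "0 \<le> T" and sol: "solution_on {0..T} Y" and y: "y = (\<lambda>k. Y k T)"
      by (rule reachableE)
    have "lyapunov (\<lambda>k. Y k T) \<le> max (lyapunov (\<lambda>k. Y k 0)) (M / \<kappa>)"
    proof (rule exponential_decay_le_max[OF T \<kappa> lyapunov_deriv[OF sol]])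
      fix t assume t: "t \<in> {0..T}"
      have "(\<lambda>k. Y k t) \<in> reachable" by (rule reachableI[OF sol]) (use t in auto)
      moreover have "(\<Sum>i\<in>UNIV. \<omega> $ i * e_of i (\<lambda>k. Y k t)) = 0"
        by (rule \<omega>_e_of[OF solution_on_subset[OF sol]]) (use t in auto)
      ultimately show "lyapunov_rate (\<lambda>k. Y k t) \<le> - \<kappa> * lyapunov (\<lambda>k. Y k t) + M"
        using rate[of "\<lambda>k. Y k t"] bspec[OF M, of "\<lambda>k. Y k t"] by linarith
    qed
    also have "lyapunov (\<lambda>k. Y k 0) = lyapunov start"
      using solution_on_start[OF sol] by (simp add: lyapunov_def e_of_def)
    finally show "\<bar>lyapunov y\<bar> \<le> max (lyapunov start) (M / \<kappa>)"
      unfolding y lyapunov_def by (subst abs_of_nonneg) (auto intro: sum_nonneg)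
  qed
qed

lemma bounded_reach_e_of: "bounded_reach (e_of i)"
proof (rule bounded_reach_square)
  show "bounded_reach (\<lambda>y. lyapunov y * (1 / \<bar>\<omega> $ i\<bar>))"
    by (intro bounded_reach_intros bounded_reach_lyapunov)
qed (use e_of_square_le in simp)

text \<open>Every state component is recovered from bounded quantities: positions from
  \<open>z_of\<close> and \<open>e_of\<close>, then velocities from \<open>s_of\<close>, and
  \<open>Acc\<close> from \<open>e_of\<close> on dividing by \<open>\<rho>\<close>.\<close>

lemma bounded_reach_signal:
  assumes "k \<in> signals"
  shows "bounded_reach (\<lambda>y. y k)"
proof -
  have "bounded_reach (\<lambda>y. z_of i y + e_of i y + target)" for i
    by (intro bounded_reach_intros bounded_reach_z_of bounded_reach_e_of)
  then have Pos: "bounded_reach (\<lambda>y. y (Pos i))" for i by (simp add: z_of_def e_of_def)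
  have "bounded_reach (\<lambda>y. s_of i y - \<rho> * dis i (\<lambda>j. y (Pos j)) - lam * z_of i y)" for i
    by (intro bounded_reach_intros bounded_reach_z_of bounded_reach_s_of Pos)
  then have Vel: "bounded_reach (\<lambda>y. y (Vel i))" for i by (simp add: s_of_def)
  have "bounded_reach (\<lambda>y. (1 / \<rho>) * (xbar i - target - e_of i y))" for i
    by (intro bounded_reach_intros bounded_reach_e_of)
  then have Acc: "bounded_reach (\<lambda>y. y (Acc i))" for i using \<rho> by (simp add: e_of_def)
  show ?thesis
    using assms Pos Vel Acc bounded_reach_Gain bounded_reach_Par by (auto simp: signals_def)
qed

section \<open>A common bound and global existence\<close>

lemma signals_uniformly_bounded: "\<exists>B. \<forall>y\<in>reachable. \<forall>k\<in>signals. \<bar>y k\<bar> \<le> B"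
proof -
  have "bounded_reach (\<lambda>y. \<Sum>k\<in>signals. \<bar>y k\<bar>)"
    using bounded_reach_signal by (intro bounded_reach_sum) (auto simp: bounded_reach_def)
  then obtain B where B: "\<forall>y\<in>reachable. \<bar>\<Sum>k\<in>signals. \<bar>y k\<bar>\<bar> \<le> B"
    by (rule bounded_reachE)
  have "\<bar>y k\<bar> \<le> B" if "y \<in> reachable" "k \<in> signals" for y k
    using member_le_sum[of k signals "\<lambda>k. \<bar>y k\<bar>"] that bspec[OF B, of y] by (simp add: abs_le_iff)
  then show ?thesis by blast
qed

text \<open>All reachable states lie in one box as far as \<open>signals\<close> are concerned, and
  a locally Lipschitz function is bounded on it.\<close>

lemma bounded_reach_locally_lipschitz:
  assumes "locally_lipschitz signals f"
  shows "bounded_reach f"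
proof -
  obtain B where B: "\<forall>y\<in>reachable. \<forall>k\<in>signals. \<bar>y k\<bar> \<le> B" using signals_uniformly_bounded by blast
  obtain M where "\<forall>y. (\<forall>k\<in>signals. \<bar>y k\<bar> \<le> B) \<longrightarrow> \<bar>f y\<bar> \<le> M"
    using locally_lipschitz_bounded[OF assms] by blast
  then show ?thesis using B by (intro bounded_reachI[of _ M]) blast
qed

text \<open>The endpoint of a solution on any \<open>{0..T}\<close> is reachable by definition, so
  the common bound is the a priori bound for the existence theorem.\<close>

lemma solution_exists: "\<exists>Y. solution_on {0..} Y"
proof -
  obtain B where B: "\<forall>y\<in>reachable. \<forall>k\<in>signals. \<bar>y k\<bar> \<le> B" using signals_uniformly_bounded by blast
  have "\<exists>Y. \<forall>k\<in>signals. Y k 0 = start k \<and>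
    (\<forall>t\<ge>0. (Y k has_real_derivative field k (\<lambda>j. Y j t)) (at t within {0..}))"
  proof (rule ode_global_solution[where B = B])
    fix T :: real and Y :: "'n signal \<Rightarrow> real \<Rightarrow> real" and k
    assume T: "T \<ge> 0" and k: "k \<in> signals" and "\<And>k. k \<in> signals \<Longrightarrow> Y k 0 = start k"
      "\<And>k t. k \<in> signals \<Longrightarrow> t \<in> {0..T} \<Longrightarrow>
        (Y k has_real_derivative field k (\<lambda>j. Y j t)) (at t within {0..T})"
    then have "solution_on {0..T} Y" by (simp add: solution_on_def)
    then have "(\<lambda>k. Y k T) \<in> reachable" using T by (auto intro: reachableI)
    then show "\<bar>Y k T\<bar> \<le> B" using B k by fast
  qed (auto intro: locally_lipschitz_field)
  then show ?thesis by (simp add: solution_on_def Ball_def)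
qed

section \<open>Convergence of a global solution\<close>

context
  fixes Y assumes sol: "solution_on {0..} Y"
begin

lemma solution_reachable: "0 \<le> t \<Longrightarrow> (\<lambda>k. Y k t) \<in> reachable"
  by (rule reachableI[OF sol]) auto

text \<open>Barbalat's lemma with the primitive potential minus energy, whose derivative is
  \<open>\<nu>\<close> times the square. It is bounded above because the potential is bounded and
  the energy nonnegative; \<open>s_rate\<close> is bounded as a locally Lipschitz function of the
  state.\<close>

lemma s_of_square_tendsto: "((\<lambda>t. (s_of i (\<lambda>k. Y k t))\<^sup>2) \<longlongrightarrow> 0) at_top"
proof -
  let ?s = "\<lambda>t. s_of i (\<lambda>k. Y k t)" and ?r = "\<lambda>t. s_rate i (\<lambda>k. Y k t)"
  have "locally_lipschitz signals (s_rate i)"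
    unfolding s_rate_def
    by (intro locally_lipschitz_dis locally_lipschitz_add locally_lipschitz_mult
        locally_lipschitz_const locally_lipschitz_component locally_lipschitz_field) auto
  then have "bounded_reach (\<lambda>y. \<nu> * (2 * s_of i y * s_rate i y))"
    by (intro bounded_reach_intros bounded_reach_s_of bounded_reach_locally_lipschitz)
  then obtain M where M: "\<forall>y\<in>reachable. \<bar>\<nu> * (2 * s_of i y * s_rate i y)\<bar> \<le> M"
    by (rule bounded_reachE)
  obtain B where B: "\<forall>y\<in>reachable. \<bar>potential i y\<bar> \<le> B"
    using bounded_reach_potential by (rule bounded_reachE)
  have "((\<lambda>t. \<nu> * (?s t)\<^sup>2) \<longlongrightarrow> 0) at_top"
  proof (rule barbalat)
    fix t :: real assume t: "t \<ge> 0"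
    show "((\<lambda>t. - (energy i (\<lambda>k. Y k t) - potential i (\<lambda>k. Y k t))) has_real_derivative
        \<nu> * (?s t)\<^sup>2) (at t within {0..})"
      using DERIV_minus[OF energy_deriv[OF sol, of t i]] t by simp
    show "((\<lambda>t. \<nu> * (?s t)\<^sup>2) has_real_derivative \<nu> * (2 * ?s t * ?r t)) (at t within {0..})"
      using t by (auto intro!: derivative_eq_intros s_of_deriv[OF sol])
    show "0 \<le> \<nu> * (?s t)\<^sup>2" using \<nu> by simp
    show "\<bar>\<nu> * (2 * ?s t * ?r t)\<bar> \<le> M" by (rule bspec[OF M solution_reachable[OF t]])
    show "- (energy i (\<lambda>k. Y k t) - potential i (\<lambda>k. Y k t)) \<le> B"
      using bspec[OF B solution_reachable[OF t]] energy_nonneg[of i "\<lambda>k. Y k t"] by linarith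
  qed
  from tendsto_mult_left[OF this, of "1 / \<nu>"] show ?thesis using \<nu> by simp
qed

lemma tendsto_0_of_square: "((\<lambda>t. (f t :: real)\<^sup>2) \<longlongrightarrow> 0) F \<Longrightarrow> (f \<longlongrightarrow> 0) F"
  using tendsto_real_sqrt[of "\<lambda>t. (f t)\<^sup>2" 0 F] by (simp add: tendsto_rabs_zero_iff)

lemma z_of_tendsto: "((\<lambda>t. z_of i (\<lambda>k. Y k t)) \<longlongrightarrow> 0) at_top"
proof (rule tendsto_0_of_square, rule exponential_decay_tendsto_0[OF lam])
  fix t :: real assume t: "t \<ge> 0"
  then show "((\<lambda>t. (z_of i (\<lambda>k. Y k t))\<^sup>2) has_real_derivative
    2 * z_of i (\<lambda>k. Y k t) * (s_of i (\<lambda>k. Y k t) - lam * z_of i (\<lambda>k. Y k t))) (at t within {0..})"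
    by (intro z_of_square_deriv[OF sol]) simp
  show "2 * z_of i (\<lambda>k. Y k t) * (s_of i (\<lambda>k. Y k t) - lam * z_of i (\<lambda>k. Y k t))
      \<le> - lam * (z_of i (\<lambda>k. Y k t))\<^sup>2 + (s_of i (\<lambda>k. Y k t))\<^sup>2 / lam"
    by (rule z_of_square_rate)
next
  show "((\<lambda>t. (s_of i (\<lambda>k. Y k t))\<^sup>2 / lam) \<longlongrightarrow> 0) at_top"
    using tendsto_divide[OF s_of_square_tendsto tendsto_const, of lam] lam by simp
qed simp

lemma dis_tendsto_0:
  assumes "\<And>j. ((\<lambda>t. g j t) \<longlongrightarrow> 0) F"
  shows "((\<lambda>t. dis i (\<lambda>j. g j t)) \<longlongrightarrow> 0) F"
proof -
  have "((\<lambda>t. dis i (\<lambda>j. g j t)) \<longlongrightarrow> dis i (\<lambda>j. 0)) F"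
    unfolding dis_def by (intro tendsto_intros assms)
  then show ?thesis by (simp add: dis_def)
qed

lemma e_of_tendsto: "((\<lambda>t. e_of i (\<lambda>k. Y k t)) \<longlongrightarrow> 0) at_top"
proof -
  obtain \<kappa> C where \<kappa>: "\<kappa> > 0" and C: "C \<ge> 0"
    and rate: "\<And>y. (\<Sum>i\<in>UNIV. \<omega> $ i * e_of i y) = 0 \<Longrightarrow>
      lyapunov_rate y \<le> - \<kappa> * lyapunov y + C * (\<Sum>i\<in>UNIV. (dis i (\<lambda>j. z_of j y))\<^sup>2)"
    using lyapunov_rate_le by blast
  have "((\<lambda>t. lyapunov (\<lambda>k. Y k t)) \<longlongrightarrow> 0) at_top"
  proof (rule exponential_decay_tendsto_0[OF \<kappa>])
    fix t :: real assume t: "t \<ge> 0"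
    then show "((\<lambda>t. lyapunov (\<lambda>k. Y k t)) has_real_derivative lyapunov_rate (\<lambda>k. Y k t)) (at t within {0..})"
      by (intro lyapunov_deriv[OF sol]) simp
    show "lyapunov_rate (\<lambda>k. Y k t) \<le> - \<kappa> * lyapunov (\<lambda>k. Y k t)
        + C * (\<Sum>i\<in>UNIV. (dis i (\<lambda>j. z_of j (\<lambda>k. Y k t)))\<^sup>2)"
      by (intro rate \<omega>_e_of[OF solution_on_subset[OF sol]]) (use t in auto)
    show "0 \<le> lyapunov (\<lambda>k. Y k t)" unfolding lyapunov_def by (auto intro: sum_nonneg)
  next
    have "((\<lambda>t. C * (\<Sum>i\<in>UNIV. (dis i (\<lambda>j. z_of j (\<lambda>k. Y k t)))\<^sup>2)) \<longlongrightarrow> C * (\<Sum>i\<in>(UNIV :: 'n set). 0\<^sup>2)) at_top"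
      by (intro tendsto_intros dis_tendsto_0 z_of_tendsto)
    then show "((\<lambda>t. C * (\<Sum>i\<in>UNIV. (dis i (\<lambda>j. z_of j (\<lambda>k. Y k t)))\<^sup>2)) \<longlongrightarrow> 0) at_top" by simp
  qed
  then have "((\<lambda>t. lyapunov (\<lambda>k. Y k t) / \<bar>\<omega> $ i\<bar>) \<longlongrightarrow> 0) at_top"
    using abs_\<omega>_pos[of i] tendsto_divide[OF _ tendsto_const, of _ 0 at_top "\<bar>\<omega> $ i\<bar>"] by force
  then have "((\<lambda>t. (e_of i (\<lambda>k. Y k t))\<^sup>2) \<longlongrightarrow> 0) at_top"
    by (rule Lim_null_comparison[rotated]) (use e_of_square_le in simp)
  then show ?thesis by (rule tendsto_0_of_square)
qed

lemma Pos_tendsto: "(Y (Pos i) \<longlongrightarrow> target) at_top"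
proof -
  have "((\<lambda>t. z_of i (\<lambda>k. Y k t) + e_of i (\<lambda>k. Y k t) + target) \<longlongrightarrow> 0 + 0 + target) at_top"
    by (intro tendsto_intros z_of_tendsto e_of_tendsto)
  then show ?thesis by (simp flip: Pos_eq[of "\<lambda>k. Y k _"])
qed

text \<open>Solve the definition of \<open>s_of\<close> for the velocity; the disagreement of the
  positions is that of \<open>z_of\<close> plus that of \<open>e_of\<close>, and everything tends to
  0.\<close>

lemma Vel_tendsto: "(Y (Vel i) \<longlongrightarrow> 0) at_top"
proof -
  have dis: "((\<lambda>t. dis i (\<lambda>j. z_of j (\<lambda>k. Y k t)) + dis i (\<lambda>j. e_of j (\<lambda>k. Y k t))) \<longlongrightarrow> 0 + 0) at_top"
    by (intro tendsto_intros dis_tendsto_0 z_of_tendsto e_of_tendsto)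
  have "((\<lambda>t. s_of i (\<lambda>k. Y k t) - \<rho> * (dis i (\<lambda>j. z_of j (\<lambda>k. Y k t)) + dis i (\<lambda>j. e_of j (\<lambda>k. Y k t)))
      - lam * z_of i (\<lambda>k. Y k t)) \<longlongrightarrow> 0 - \<rho> * (0 + 0) - lam * 0) at_top"
    by (intro tendsto_intros z_of_tendsto tendsto_0_of_square[OF s_of_square_tendsto] dis[simplified] dis)
  moreover have "s_of i (\<lambda>k. Y k t) - \<rho> * (dis i (\<lambda>j. z_of j (\<lambda>k. Y k t)) + dis i (\<lambda>j. e_of j (\<lambda>k. Y k t)))
      - lam * z_of i (\<lambda>k. Y k t) = Y (Vel i) t" for t
    unfolding dis_Pos[symmetric] s_of_def by simp
  ultimately show ?thesis by simp
qed

lemma bounded_along: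
  assumes "bounded_reach f"
  shows "bounded ((\<lambda>t. f (\<lambda>k. Y k t)) ` {0..})"
proof -
  obtain B where "\<forall>y\<in>reachable. \<bar>f y\<bar> \<le> B" using assms by (rule bounded_reachE)
  then show ?thesis using solution_reachable by (auto simp: bounded_iff intro!: exI[of _ B])
qed

end

end

section \<open>Translation between the closed loop and the autonomous system\<close>

theorem theorem2:
  fixes E :: "('n::finite \<times> 'n) set"
    and A :: "real^'n^'n"
    and l :: "'n \<Rightarrow> nat"
    and \<phi> :: "'n \<Rightarrow> real \<times> real \<Rightarrow> nat \<Rightarrow> real"
    and b :: "'n \<Rightarrow> real"
    and \<theta> :: "'n \<Rightarrow> nat \<Rightarrow> real"
    and \<rho> lam \<nu> :: real
    and \<gamma> xbar :: "'n \<Rightarrow> real"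
    and \<omega> :: "real^'n"
    and x0 v0 \<zeta>0 :: "'n \<Rightarrow> real"
    and \<theta>0 :: "'n \<Rightarrow> nat \<Rightarrow> real"
  assumes "adjacency_matrix E A"
    and "strongly_connected E"
    and "\<And>i. b i \<noteq> 0"
    and "\<And>i k. k < l i \<Longrightarrow> smooth (\<lambda>p. \<phi> i p k)"
    and "\<rho> > 0" and "lam > 0" and "\<nu> > 0"
    and "\<And>i. \<gamma> i > 0"
    and "\<omega> v* laplacian A = 0"
    and "(\<Sum>k\<in>UNIV. \<omega> $ k) = 1"
  shows "(\<exists>x v \<theta>h \<zeta>. closed_loop E A l \<phi> b \<theta> \<rho> lam \<nu> \<gamma> xbar x v \<theta>h \<zeta> \<and>
             initial_conditions l x0 v0 \<theta>0 \<zeta>0 x v \<theta>h \<zeta>) \<and>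
         (\<forall>x v \<theta>h \<zeta>. closed_loop E A l \<phi> b \<theta> \<rho> lam \<nu> \<gamma> xbar x v \<theta>h \<zeta> \<longrightarrow>
             initial_conditions l x0 v0 \<theta>0 \<zeta>0 x v \<theta>h \<zeta> \<longrightarrow>
           (\<forall>i. bounded (x i ` {0..}) \<and>
                bounded (v i ` {0..}) \<and>
                bounded (z_signal E A \<rho> xbar x i ` {0..}) \<and>
                bounded (s_signal E A \<rho> lam xbar x v i ` {0..}) \<and>
                bounded (integral_term E A x i ` {0..}) \<and>
                (\<forall>k<l i. bounded (\<theta>h i k ` {0..})) \<and>
                bounded (\<zeta> i ` {0..}) \<and>
                bounded (control E A l \<phi> \<rho> lam \<nu> xbar x v \<theta>h \<zeta> i ` {0..})) \<and>
           (\<forall>i j. ((\<lambda>t. x i t - x j t) \<longlongrightarrow> 0) at_top \<and>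
                  ((\<lambda>t. v i t - v j t) \<longlongrightarrow> 0) at_top) \<and>
           (\<forall>i. (x i \<longlongrightarrow> (\<Sum>k\<in>UNIV. \<omega> $ k * xbar k)) at_top \<and>
                (v i \<longlongrightarrow> 0) at_top))"
proof -
  interpret consensus_loop E A l \<phi> b \<theta> \<rho> lam \<nu> \<gamma> xbar \<omega> x0 v0 \<zeta>0 \<theta>0
    by unfold_locales (use assms in auto)
  have disagreement_eq: "disagreement E A y i t = dis i (\<lambda>j. y j t)" for y i t
    by (simp add: disagreement_def dis_def)
  \<comment> \<open>Stated at a single time, because for a constructed solution the premise on
    \<open>Acc\<close> will be available only for \<open>t \<ge> 0\<close>.\<close>
  have signal_eqs: "z_signal E A \<rho> xbar x i t = z_of i (\<lambda>k. Y k t)"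
    "s_signal E A \<rho> lam xbar x v i t = s_of i (\<lambda>k. Y k t)"
    "feedback E A l \<phi> \<rho> lam x v \<theta>h i t = feedback_of i (\<lambda>k. Y k t)"
    "control E A l \<phi> \<rho> lam \<nu> xbar x v \<theta>h \<zeta> i t = control_of i (\<lambda>k. Y k t)"
    if "\<And>i. Y (Pos i) t = x i t" "\<And>i. Y (Vel i) t = v i t" "\<And>i. Y (Acc i) t = integral_term E A x i t"
      "\<And>i. Y (Gain i) t = \<zeta> i t" "\<And>i k. Y (Par i k) t = \<theta>h i k t"
    for x v \<theta>h \<zeta> and Y :: "'n signal \<Rightarrow> real \<Rightarrow> real" and i t
    by (simp_all add: that z_signal_def s_signal_def feedback_def control_def
        z_of_def s_of_def feedback_of_def control_of_def disagreement_eq)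
  show ?thesis
  proof (intro conjI allI impI)
    obtain Y where sol: "solution_on {0..} Y" using solution_exists by blast
    have Acc: "integral_term E A (\<lambda>i. Y (Pos i)) i t = Y (Acc i) t" if t: "t \<ge> 0" for i t
    proof -
      \<comment> \<open>The state \<open>Acc\<close> starts at 0 with the disagreement as its rate,
        so it is the integral term by the fundamental theorem of calculus.\<close>
      have "((\<lambda>t. dis i (\<lambda>j. Y (Pos j) t)) has_integral Y (Acc i) t - Y (Acc i) 0) {0..t}"
      proof (rule fundamental_theorem_of_calculus[OF t])
        fix s assume s: "s \<in> {0..t}"
        have "(Y (Acc i) has_real_derivative dis i (\<lambda>j. Y (Pos j) s)) (at s within {0..t})"
          using solution_on_deriv[OF solution_on_subset[OF sol], of "{0..t}" "Acc i" s] s by auto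
        then show "(Y (Acc i) has_vector_derivative dis i (\<lambda>j. Y (Pos j) s)) (at s within {0..t})"
          by (simp add: has_real_derivative_iff_has_vector_derivative)
      qed
      then show ?thesis using solution_on_start[OF sol, of "Acc i"]
        by (simp add: integral_term_def disagreement_eq [abs_def] integral_unique)
    qed
    note eqs = signal_eqs[of Y _ "\<lambda>i. Y (Pos i)" "\<lambda>i. Y (Vel i)" "\<lambda>i. Y (Gain i)" "\<lambda>i k. Y (Par i k)",
        OF refl refl Acc[symmetric] refl refl]
    have "closed_loop E A l \<phi> b \<theta> \<rho> lam \<nu> \<gamma> xbar
        (\<lambda>i. Y (Pos i)) (\<lambda>i. Y (Vel i)) (\<lambda>i k. Y (Par i k)) (\<lambda>i. Y (Gain i))"
      unfolding closed_loop_def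
    proof (intro allI impI conjI)
      fix i and t :: real assume t: "t \<ge> 0"
      note d = solution_on_deriv[OF sol, of _ t]
      show "(Y (Pos i) has_real_derivative Y (Vel i) t) (at t within {0..})"
        using d[of "Pos i"] t by simp
      show "(Y (Vel i) has_real_derivative
          b i * control E A l \<phi> \<rho> lam \<nu> xbar (\<lambda>i. Y (Pos i)) (\<lambda>i. Y (Vel i)) (\<lambda>i k. Y (Par i k)) (\<lambda>i. Y (Gain i)) i t
           + dot (l i) (\<theta> i) (\<phi> i (Y (Pos i) t, Y (Vel i) t))) (at t within {0..})"
        using d[of "Vel i"] t by (simp add: eqs)
      show "(Y (Par i k) has_real_derivative
           \<gamma> i * \<phi> i (Y (Pos i) t, Y (Vel i) t) k * s_signal E A \<rho> lam xbar (\<lambda>i. Y (Pos i)) (\<lambda>i. Y (Vel i)) i t)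
           (at t within {0..})" if "k < l i" for k
        using d[of "Par i k"] t that by (simp add: eqs)
      show "(Y (Gain i) has_real_derivative
           \<nu> * (s_signal E A \<rho> lam xbar (\<lambda>i. Y (Pos i)) (\<lambda>i. Y (Vel i)) i t)\<^sup>2
           + s_signal E A \<rho> lam xbar (\<lambda>i. Y (Pos i)) (\<lambda>i. Y (Vel i)) i t
             * feedback E A l \<phi> \<rho> lam (\<lambda>i. Y (Pos i)) (\<lambda>i. Y (Vel i)) (\<lambda>i k. Y (Par i k)) i t)
          (at t within {0..})"
        using d[of "Gain i"] t by (simp add: eqs)
    qed
    moreover have "initial_conditions l x0 v0 \<theta>0 \<zeta>0
        (\<lambda>i. Y (Pos i)) (\<lambda>i. Y (Vel i)) (\<lambda>i k. Y (Par i k)) (\<lambda>i. Y (Gain i))"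
      using solution_on_start[OF sol] by (simp add: initial_conditions_def)
    ultimately show "\<exists>x v \<theta>h \<zeta>. closed_loop E A l \<phi> b \<theta> \<rho> lam \<nu> \<gamma> xbar x v \<theta>h \<zeta> \<and>
             initial_conditions l x0 v0 \<theta>0 \<zeta>0 x v \<theta>h \<zeta>" by blast
  next
    fix x v \<theta>h \<zeta>
    assume cl: "closed_loop E A l \<phi> b \<theta> \<rho> lam \<nu> \<gamma> xbar x v \<theta>h \<zeta>"
      and init: "initial_conditions l x0 v0 \<theta>0 \<zeta>0 x v \<theta>h \<zeta>"
    \<comment> \<open>Conversely, any closed-loop solution becomes a solution of the autonomous
      system once its integral term is added as the state \<open>Acc\<close>; all bounds and limits
      then carry over.\<close>
    define Y where "Y k = (case k of Pos i \<Rightarrow> x i | Vel i \<Rightarrow> v i | Acc i \<Rightarrow> integral_term E A x i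
      | Gain i \<Rightarrow> \<zeta> i | Par i k \<Rightarrow> \<theta>h i k)" for k
    have Y [simp]: "Y (Pos i) = x i" "Y (Vel i) = v i" "Y (Acc i) = integral_term E A x i"
      "Y (Gain i) = \<zeta> i" "Y (Par i k) = \<theta>h i k" for i k
      by (simp_all add: Y_def)
    note eqs = signal_eqs[of Y _ x v \<zeta> \<theta>h, simplified]
    have x_cont: "continuous_on {0..} (x i)" for i
      using cl by (intro DERIV_continuous_on[where D = "v i"]) (auto simp: closed_loop_def)
    have Acc: "(integral_term E A x i has_real_derivative dis i (\<lambda>j. x j t)) (at t within {0..})"
      if t: "t \<ge> 0" for i t
    proof -
      have "continuous_on {0..t+1} (disagreement E A x i)"
        unfolding disagreement_def [abs_def]
        by (intro continuous_intros continuous_on_subset[OF x_cont]) auto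
      then have "((\<lambda>t. integral {0..t} (disagreement E A x i)) has_real_derivative
          disagreement E A x i t) (at t within {0..t+1})"
        by (rule integral_has_real_derivative) (use t in auto)
      moreover have "at t within {0..t+1} = at t within {0..}"
        by (rule at_within_nhd[of _ "{..<t+1}"]) (use t in auto)
      ultimately show ?thesis by (simp add: integral_term_def [abs_def] disagreement_eq)
    qed
    have sol: "solution_on {0..} Y"
      unfolding solution_on_def
    proof (intro ballI conjI)
      fix k assume k: "k \<in> signals"
      show "Y k 0 = start k"
        using init k by (auto simp: signals_def initial_conditions_def integral_term_def)
      fix t :: real assume "t \<in> {0..}"
      then show "(Y k has_real_derivative field k (\<lambda>j. Y j t)) (at t within {0..})"
        using cl k Acc[of t] unfolding closed_loop_def signals_def by (auto simp: eqs)
    qed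
    have bounds: "bounded ((\<lambda>t. f (\<lambda>k. Y k t)) ` {0..})" if "bounded_reach f" for f
      using bounded_along[OF sol that] .
    have signal_bounds: "bounded (Y k ` {0..})" if "k \<in> signals" for k
      using bounds[OF bounded_reach_signal[OF that]] by simp
    show "bounded (x i ` {0..})" "bounded (v i ` {0..})" "bounded (integral_term E A x i ` {0..})"
      "bounded (\<zeta> i ` {0..})" for i
      using signal_bounds[of "Pos i"] signal_bounds[of "Vel i"] signal_bounds[of "Acc i"]
        signal_bounds[of "Gain i"] by simp_all
    show "bounded (\<theta>h i k ` {0..})" if "k < l i" for i k
      using signal_bounds[of "Par i k"] that by simp
    show "bounded (z_signal E A \<rho> xbar x i ` {0..})" for i
      using bounds[OF bounded_reach_z_of, of i] by (simp flip: eqs)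
    show "bounded (s_signal E A \<rho> lam xbar x v i ` {0..})" for i
      using bounds[OF bounded_reach_s_of, of i] by (simp flip: eqs)
    show "bounded (control E A l \<phi> \<rho> lam \<nu> xbar x v \<theta>h \<zeta> i ` {0..})" for i
      using bounds[OF bounded_reach_locally_lipschitz[OF locally_lipschitz_control_of], of i]
      by (simp flip: eqs)
    have x: "(x i \<longlongrightarrow> target) at_top" and v: "(v i \<longlongrightarrow> 0) at_top" for i
      using Pos_tendsto[OF sol, of i] Vel_tendsto[OF sol, of i] by simp_all
    show "(x i \<longlongrightarrow> (\<Sum>k\<in>UNIV. \<omega> $ k * xbar k)) at_top" for i
      using x by (simp add: target_def)
    show "(v i \<longlongrightarrow> 0) at_top" for i by (rule v)
    show "((\<lambda>t. x i t - x j t) \<longlongrightarrow> 0) at_top" for i j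
      using tendsto_diff[OF x[of i] x[of j]] by simp
    show "((\<lambda>t. v i t - v j t) \<longlongrightarrow> 0) at_top" for i j
      using tendsto_diff[OF v[of i] v[of j]] by simp
  qed
qed

end
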